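(* Let $a \geq 0$. Then in the connection formula $N_{W}(a,x)=c_{0}^{+}(a)W(a,x)+c_{0}^{-}(a)W(a,-x)-\hat{N}_{W}(a,x)$ we have \[ c_{0}^{+}(a)=W(a,0)\left[\sqrt {\pi} e^{\pi a/2}\left\{1+\left(1+e^{-2\pi a}\right)^{-1/2}\right\}-4Y(a)\left\{W'(a,0)\right\}^{2}\right], \] \[ c_{0}^{-}(a)=-W(a,0) \left[4Y(a)\left\{W'(a,0)\right\}^{2}+ \sqrt {\pi} e^{-3\pi a/2}\left\{1+e^{-2\pi a}+\left(1+e^{-2\pi a}\right)^{1/2}\right\}^{-1}\right], \] and \[ c_{0}^{\pm}(-a)=W(a,0)\left[4Y(a)\left\{W'(a,0)\right\}^{2}\pm \sqrt {\pi} e^{-\pi a/2}\left\{1 \pm \left(1+e^{2\pi a}\right)^{-1/2}\right\}\right], \] where \[ W\left(a,0\right)=2^{-3/4}\left|\frac{\Gamma\left(\tfrac{1}{4}+\tfrac{1}{2}ia\right)}{\Gamma\left(\tfrac{3}{4}+\tfrac{1}{2}ia\right)}\right|^{1/2},\quad W'\left(a,0\right)=-2^{-1/4}\left|\frac{\Gamma\left(\tfrac{3}{4}+\tfrac{1}{2}ia\right)}{\Gamma\left(\tfrac{1}{4}+\tfrac{1}{2}ia\right)}\right|^{1/2}, \] \[ Y(a)= \Im\left\{ (1-2ia)^{-1}F\left(\tfrac{1}{2}, 1;\tfrac{5}{4}-\tfrac{1}{2}ia;\tfrac{1}{2}\right)\right\}, \] and $F$ is the (unscaled) Gauss hypergeometric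 function, given by the rapidly converging series $F(a,b;c;z)=\Gamma(c)\sum_{s\ge0}\frac{(a)_s(b)_s z^s}{\Gamma(c+s)s!}$.
   Context: $a$ is real; $W(a,\pm x)$ are the Weber parabolic cylinder functions (DLMF Sect. 12.14), solutions of $y''+(\tfrac14 x^2-a)y=0$. $N_{W}(a,x)=W(a,x) \int_{0}^x W(a,-t)dt-W(a,-x)\int_{0}^x W(a,t)dt$ (Nield-Kuznetsov function of the first kind) and $\hat{N}_{W}(a,x)=W(a,x)\int_{x}^{\infty} W(a,-t)dt-W(a,-x) \int_{x}^{\infty} W(a,t)dt$ (complementary Nield-Kuznetsov function). The connection coefficients are $c_{0}^{\pm}(a)=\mp \hat{N}_{W}'(a,0)W(a,0) - \hat{N}_{W}(a,0)W'(a,0)$. *)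

theory Defs
  imports "HOL-Analysis.Analysis"
begin

text \<open>Power-series coefficients of the even and odd solutions w1, w2 of
  y'' + (x^2/4 - a) y = 0 (DLMF 12.14.8--12.14.9).\<close>

fun weber_alpha :: "real \<Rightarrow> nat \<Rightarrow> real" where
  "weber_alpha a 0 = 1"
| "weber_alpha a (Suc 0) = a"
| "weber_alpha a (Suc (Suc n)) =
     a * weber_alpha a (Suc n) - (real n + 1) * (2 * real n + 1) / 2 * weber_alpha a n"

fun weber_beta :: "real \<Rightarrow> nat \<Rightarrow> real" where
  "weber_beta a 0 = 1"
| "weber_beta a (Suc 0) = a"
| "weber_beta a (Suc (Suc n)) =
     a * weber_beta a (Suc n) - (real n + 1) * (2 * real n + 3) / 2 * weber_beta a n"

definition weber_w1 :: "real \<Rightarrow> real \<Rightarrow> real" where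
  "weber_w1 a x = (\<Sum>n. weber_alpha a n * x ^ (2 * n) / fact (2 * n))"

definition weber_w2 :: "real \<Rightarrow> real \<Rightarrow> real" where
  "weber_w2 a x = (\<Sum>n. weber_beta a n * x ^ (2 * n + 1) / fact (2 * n + 1))"

definition weber_G1 :: "real \<Rightarrow> real" where
  "weber_G1 a = cmod (Gamma (Complex (1/4) (a/2)))"

definition weber_G3 :: "real \<Rightarrow> real" where
  "weber_G3 a = cmod (Gamma (Complex (3/4) (a/2)))"

text \<open>Weber parabolic cylinder function W(a,x), DLMF 12.14.10:
  W(a, \<plusminus>x) = 2^(-3/4) (sqrt(G1/G3) w1(a,x) \<mp> sqrt(2 G3/G1) w2(a,x)).\<close>
definition W :: "real \<Rightarrow> real \<Rightarrow> real" where
  "W a x = 2 powr (-3/4) *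
     (sqrt (weber_G1 a / weber_G3 a) * weber_w1 a x
      - sqrt (2 * weber_G3 a / weber_G1 a) * weber_w2 a x)"

text \<open>Improper integral from x to infinity (as a limit; the integrands
  here are only conditionally convergent).\<close>
definition int_to_infty :: "(real \<Rightarrow> real) \<Rightarrow> real \<Rightarrow> real" where
  "int_to_infty f x = Lim at_top (\<lambda>R. integral {x..R} f)"

definition NW_hat :: "real \<Rightarrow> real \<Rightarrow> real" where
  "NW_hat a x = W a x * int_to_infty (\<lambda>t. W a (- t)) x
               - W a (- x) * int_to_infty (\<lambda>t. W a t) x"

definition c0_plus :: "real \<Rightarrow> real" where
  "c0_plus a = - deriv (NW_hat a) 0 * W a 0 - NW_hat a 0 * deriv (W a) 0"

definition c0_minus :: "real \<Rightarrow> real" where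
  "c0_minus a = deriv (NW_hat a) 0 * W a 0 - NW_hat a 0 * deriv (W a) 0"

definition hypergeomF :: "complex \<Rightarrow> complex \<Rightarrow> complex \<Rightarrow> complex \<Rightarrow> complex" where
  "hypergeomF p q c z = Gamma c *
     (\<Sum>s. pochhammer p s * pochhammer q s * z ^ s / (Gamma (c + of_nat s) * fact s))"

definition Y :: "real \<Rightarrow> real" where
  "Y a = Im (inverse (1 - 2 * \<i> * of_real a) *
            hypergeomF (1/2) 1 (Complex (5/4) (- a/2)) (1/2))"

end

theory Submission
  imports Defs "HOL-Complex_Analysis.Complex_Analysis"
begin

text \<open>
  Since \<open>W(a,0) W'(a,0) = -1/2\<close>, the coefficients \<open>c\<^sub>0\<^sup>+\<close> and \<open>- c\<^sub>0\<^sup>-\<close> are the integrals of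
  \<open>W(a,-t)\<close> and \<open>W(a,t)\<close> over the half line, so everything reduces to the improper integrals of the
  even and odd solutions \<open>w\<^sub>1\<close>, \<open>w\<^sub>2\<close>. With \<open>s = 1/4 + ia/2\<close>, the Euler integral
  \<open>h(x) = \<integral> e^(i x^2 v / 4) (1 - v)^(s - 1) (1 + v)^(s' - 1) dv\<close> over \<open>0 < v < 1\<close>, where \<open>s'\<close> is the conjugate of
  \<open>s\<close>, satisfies \<open>h'' = (a - x^2/4) h + i\<close>. Hence \<open>Re h\<close> is a multiple of \<open>w\<^sub>1\<close> while \<open>g = Im h\<close> solves an
  inhomogeneous equation, and Green's identity gives
  \<open>\<integral> w dx = (w g' - g w')(R) - (w g' - g w')(0)\<close> over \<open>0 < x < R\<close>, for both solutions. The boundary term at \<open>0\<close> is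
  \<open>g(0) = -2 Y(a)\<close> for \<open>w\<^sub>2\<close> and vanishes for \<open>w\<^sub>1\<close>; the one at \<open>R\<close> converges because \<open>h\<close>, and the analogous integral
  with \<open>s = 3/4 + ia/2\<close> representing \<open>w\<^sub>2\<close>, have explicit leading asymptotics given by the endpoint \<open>v = 1\<close>. The
  reflection formula for the Gamma function and the Beta integral then evaluate the constants.
\<close>

section \<open>The Beta integral with complex parameters\<close>

text \<open>The integrals of \<open>W a\<close> converge only conditionally, which rules out
  domination on the half line; Green's identity gives a closed form at each finite R, so that only
  leading asymptotics remain to be controlled. Cutting the Euler integral at v = 0 is deliberate.
  Over -1 < v < 1 it would be a Kummer integral solving the homogeneous equation. Conjugation
  combined with v -> -v swaps the two halves, so Re h is half of that full integral, while the new
  endpoint v = 0 leaves the constant i. Its imaginary part is the right-hand side 1 that makes the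
  Wronskian of y and Im h a primitive of y itself. Both h and its derivative carry the oscillating
  factor exp (i R^2 / 4). The boundary term at R converges nevertheless: all moments in v have the
  same leading coefficient at v = 1, and the phases for the exponents 1/4 + ia/2 and 3/4 + ia/2
  differ only by the positive factor R / 2, so the oscillation cancels in the products.\<close>

lemma norm_powr_pos: "x > 0 \<Longrightarrow> cmod (complex_of_real x powr z) = x powr Re z"
  by (simp add: norm_powr_real_powr)

text \<open>Extended by zero to the whole line, so that a product of two Gamma values is an integral
  over the plane and the convolution restricts itself to 0 < t < u.\<close>

definition gamma_kernel :: "complex \<Rightarrow> real \<Rightarrow> complex" where
  "gamma_kernel z t = indicator {0<..} t *\<^sub>R (complex_of_real t powr (z - 1) / of_real (exp t))"

lemma gamma_kernel:
  assumes "Re z > 0"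
  shows integrable_gamma_kernel: "integrable lborel (gamma_kernel z)"
    and integral_gamma_kernel: "integral\<^sup>L lborel (gamma_kernel z) = Gamma z"
    and measurable_gamma_kernel: "gamma_kernel z \<in> borel_measurable borel"
proof -
  have *: "set_integrable lebesgue {0<..} (\<lambda>t. complex_of_real t powr (z - 1) / of_real (exp t))"
    using absolutely_integrable_Gamma_integral'[OF assms] .
  show m: "gamma_kernel z \<in> borel_measurable borel"
    unfolding gamma_kernel_def
    by (auto intro!: borel_measurable_continuous_on_indicator continuous_intros)
  have "integrable lebesgue (gamma_kernel z)"
    using * unfolding set_integrable_def gamma_kernel_def .
  then show "integrable lborel (gamma_kernel z)"
    using m by (simp add: integrable_completion)
  have "(LINT t:{0<..}|lebesgue. complex_of_real t powr (z - 1) / of_real (exp t)) = Gamma z"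
    using set_lebesgue_integral_eq_integral(2)[OF *] Gamma_integral_complex'[OF assms]
    by (simp add: integral_unique)
  then have "integral\<^sup>L lebesgue (gamma_kernel z) = Gamma z"
    unfolding set_lebesgue_integral_def gamma_kernel_def .
  then show "integral\<^sup>L lborel (gamma_kernel z) = Gamma z"
    using m by (simp add: integral_completion)
qed

definition beta_kernel :: "complex \<Rightarrow> complex \<Rightarrow> real \<Rightarrow> complex" where
  "beta_kernel p q t = complex_of_real t powr (p - 1) * complex_of_real (1 - t) powr (q - 1)"

text \<open>Under t = u * x the exponentials combine to exp (- u), and homogeneity of the powers
  splits off u powr (p + q - 1), leaving the Beta integrand in x.\<close>

lemma gamma_kernel_convolution:
  assumes u: "u > 0"
  shows "(\<integral>t. gamma_kernel p t * gamma_kernel q (u - t) \<partial>lborel) =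
    gamma_kernel (p + q) u * (\<integral>x. indicator {0<..<1} x *\<^sub>R beta_kernel p q x \<partial>lborel)"
proof -
  have "(\<integral>t. gamma_kernel p t * gamma_kernel q (u - t) \<partial>lborel) =
    \<bar>u\<bar> *\<^sub>R (\<integral>x. gamma_kernel p (0 + u * x) * gamma_kernel q (u - (0 + u * x)) \<partial>lborel)"
    using u by (intro lborel_integral_real_affine) auto
  also have "(\<lambda>x. gamma_kernel p (0 + u * x) * gamma_kernel q (u - (0 + u * x))) =
    (\<lambda>x. (gamma_kernel (p + q) u / of_real u) * (indicator {0<..<1} x *\<^sub>R beta_kernel p q x))"
  proof (rule ext)
    fix x :: real
    show "gamma_kernel p (0 + u * x) * gamma_kernel q (u - (0 + u * x)) =
      (gamma_kernel (p + q) u / of_real u) * (indicator {0<..<1} x *\<^sub>R beta_kernel p q x)"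
    proof (cases "0 < x \<and> x < 1")
      case True
      have e: "u - u * x = u * (1 - x)" by (simp add: algebra_simps)
      have 1: "complex_of_real (u * x) powr (p - 1) = of_real u powr (p - 1) * of_real x powr (p - 1)"
        using u True by (simp add: powr_times_real)
      have 2: "complex_of_real (u * (1 - x)) powr (q - 1) = of_real u powr (q - 1) * of_real (1 - x) powr (q - 1)"
        using u True by (simp add: powr_times_real del: of_real_diff)
      have 3: "complex_of_real u powr (p + q - 1) = of_real u powr (p - 1) * of_real u powr (q - 1) * of_real u"
      proof -
        have "p + q - 1 = (p - 1) + (q - 1) + 1" by simp
        then show ?thesis using u by (simp only: powr_add) simp
      qed
      have 4: "complex_of_real (exp (u * x)) * of_real (exp (u * (1 - x))) = of_real (exp u)"
        by (simp flip: of_real_mult exp_add add: algebra_simps)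
      have "u * x < u" using u True by simp
      then show ?thesis
        using u True unfolding gamma_kernel_def beta_kernel_def e
        by (simp add: e del: of_real_mult of_real_diff, simp only: 1 2 3 4[symmetric],
            simp add: field_simps del: of_real_mult of_real_diff)
    next
      case False
      then have "u * x \<le> 0 \<or> u - u * x \<le> 0"
        using u by (auto simp: not_less mult_nonneg_nonpos)
      then show ?thesis using False by (auto simp: gamma_kernel_def)
    qed
  qed
  finally show ?thesis using u by (simp add: scaleR_conv_of_real)
qed

text \<open>Fubini for \<open>gamma_kernel p t * gamma_kernel q (u - t)\<close>: integrating over u
  first separates the variables by translation invariance, integrating over t first gives the
  convolution. Absolute integrability comes from the same translation applied to the norms.\<close>

lemma Beta_integral_lborel:
  assumes p: "Re p > 0" and q: "Re q > 0"
  shows "Gamma p * Gamma q =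
    Gamma (p + q) * (\<integral>x. indicator {0<..<1} x *\<^sub>R beta_kernel p q x \<partial>lborel)"
proof -
  let ?g = "\<lambda>(t, u). gamma_kernel p t * gamma_kernel q (u - t)"
  note [measurable] = measurable_gamma_kernel[OF p] measurable_gamma_kernel[OF q]
  have shift: "integrable lborel (\<lambda>u. gamma_kernel q (u - t))"
    "(\<integral>u. gamma_kernel q (u - t) \<partial>lborel) = Gamma q"
    "(\<integral>u. norm (gamma_kernel q (u - t)) \<partial>lborel) = (\<integral>u. norm (gamma_kernel q u) \<partial>lborel)" for t
    using lborel_integrable_real_affine[OF integrable_gamma_kernel[OF q], of 1 "-t"]
      lborel_integral_real_affine[of 1 "gamma_kernel q" "-t"]
      lborel_integral_real_affine[of 1 "\<lambda>u. norm (gamma_kernel q u)" "-t"]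
      integral_gamma_kernel[OF q]
    by (simp_all add: algebra_simps)
  have int: "integrable (lborel \<Otimes>\<^sub>M lborel) ?g"
  proof (rule lborel_pair.Fubini_integrable)
    show "?g \<in> borel_measurable (lborel \<Otimes>\<^sub>M lborel)" by measurable
    show "integrable lborel (\<lambda>t. \<integral>u. norm (?g (t, u)) \<partial>lborel)"
      using integrable_gamma_kernel[OF p] by (simp add: norm_mult shift)
    show "AE t in lborel. integrable lborel (\<lambda>u. ?g (t, u))"
      by (simp add: shift)
  qed
  have "Gamma p * Gamma q = (\<integral>t. (\<integral>u. gamma_kernel p t * gamma_kernel q (u - t) \<partial>lborel) \<partial>lborel)"
    by (simp add: shift integral_gamma_kernel[OF p])
  also have "\<dots> = (\<integral>u. (\<integral>t. gamma_kernel p t * gamma_kernel q (u - t) \<partial>lborel) \<partial>lborel)"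
    using lborel_pair.Fubini_integral[OF int] by simp
  also have "\<dots> = (\<integral>u. gamma_kernel (p + q) u *
      (\<integral>x. indicator {0<..<1} x *\<^sub>R beta_kernel p q x \<partial>lborel) \<partial>lborel)"
  proof (rule Bochner_Integration.integral_cong[OF refl])
    fix u :: real
    show "(\<integral>t. gamma_kernel p t * gamma_kernel q (u - t) \<partial>lborel) = gamma_kernel (p + q) u *
      (\<integral>x. indicator {0<..<1} x *\<^sub>R beta_kernel p q x \<partial>lborel)"
    proof (cases "u > 0")
      case True
      then show ?thesis by (rule gamma_kernel_convolution)
    next
      case False
      then have "(\<lambda>t. gamma_kernel p t * gamma_kernel q (u - t)) = (\<lambda>t. 0)"
        by (auto simp: gamma_kernel_def indicator_def)
      then show ?thesis using False by (simp only: Bochner_Integration.integral_zero) (simp add: gamma_kernel_def)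
    qed
  qed
  also have "\<dots> = Gamma (p + q) * (\<integral>x. indicator {0<..<1} x *\<^sub>R beta_kernel p q x \<partial>lborel)"
    using integral_gamma_kernel[of "p + q"] p q by simp
  finally show ?thesis .
qed

lemma continuous_on_of_real_powr:
  fixes f :: "'a::topological_space \<Rightarrow> real"
  assumes "continuous_on A f" "\<And>x. x \<in> A \<Longrightarrow> f x > 0"
  shows "continuous_on A (\<lambda>x. complex_of_real (f x) powr c)"
  using assms by (intro continuous_intros) (auto simp: complex_nonpos_Reals_iff dest!: assms(2))

lemma absolutely_integrable_beta_kernel:
  assumes p: "Re p > 0" and q: "Re q > 0"
  shows "beta_kernel p q absolutely_integrable_on {0<..<1}"
proof (rule measurable_bounded_by_integrable_imp_absolutely_integrable)
  show "beta_kernel p q \<in> borel_measurable (lebesgue_on {0<..<1})"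
    unfolding beta_kernel_def
    by (intro continuous_imp_measurable_on_sets_lebesgue continuous_intros continuous_on_of_real_powr) auto
  show "(\<lambda>t. t powr (Re p - 1) * (1 - t) powr (Re q - 1)) integrable_on {0<..<1}"
    using has_integral_Beta_real[OF p q] by (auto simp: has_integral_Icc_iff_Ioo integrable_on_def)
  show "cmod (beta_kernel p q t) \<le> t powr (Re p - 1) * (1 - t) powr (Re q - 1)" if "t \<in> {0<..<1}" for t
    using that by (simp add: beta_kernel_def norm_mult norm_powr_pos del: of_real_diff)
qed auto

lemma has_integral_Beta_complex:
  assumes p: "Re p > 0" and q: "Re q > 0"
  shows "(beta_kernel p q has_integral Beta p q) {0..1}"
proof -
  have m: "(\<lambda>x. indicator {0<..<1} x *\<^sub>R beta_kernel p q x) \<in> borel_measurable borel"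
    unfolding beta_kernel_def
    by (intro borel_measurable_continuous_on_indicator continuous_intros continuous_on_of_real_powr) auto
  have "Gamma (p + q) \<noteq> 0"
  proof -
    have "p + q \<notin> \<int>\<^sub>\<le>\<^sub>0"
    proof
      assume "p + q \<in> \<int>\<^sub>\<le>\<^sub>0"
      then obtain n where "p + q = of_int n" "n \<le> 0" by (elim nonpos_Ints_cases)
      then have "Re (p + q) \<le> 0" by simp
      then show False using p q by simp
    qed
    then show ?thesis by (simp add: Gamma_eq_zero_iff)
  qed
  then have "(\<integral>x. indicator {0<..<1} x *\<^sub>R beta_kernel p q x \<partial>lborel) = Beta p q"
    using Beta_integral_lborel[OF p q] by (simp add: Beta_def field_simps)
  then have "(LINT x:{0<..<1}|lebesgue. beta_kernel p q x) = Beta p q"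
    unfolding set_lebesgue_integral_def using m by (simp add: integral_completion)
  then have "(beta_kernel p q has_integral Beta p q) {0<..<1}"
    using absolutely_integrable_beta_kernel[OF p q]
    by (metis has_integral_set_lebesgue)
  then show ?thesis by (simp add: has_integral_Icc_iff_Ioo)
qed

section \<open>The Gamma integral along the imaginary axis\<close>

text \<open>Besides the power of the modulus only exp (- Im w * arg z) occurs, and the argument is
  at most pi / 2 in absolute value on the closed right half plane.\<close>

lemma norm_powr_le_right_half_plane:
  assumes z: "z \<noteq> 0" "Re z \<ge> 0"
  shows "cmod (z powr w) \<le> cmod z powr Re w * exp (pi / 2 * \<bar>Im w\<bar>)"
proof -
  have arg: "\<bar>Im (Ln z)\<bar> \<le> pi / 2"
    using z(2) by (subst Re_Ln_pos_le[OF z(1)])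
  have "cmod (z powr w) = exp (Re w * ln (cmod z) - Im w * Im (Ln z))"
    using z by (simp add: powr_def)
  also have "\<dots> = cmod z powr Re w * exp (- (Im w * Im (Ln z)))"
    using z by (simp add: powr_def exp_diff exp_minus field_simps)
  also have "\<dots> \<le> cmod z powr Re w * exp (pi / 2 * \<bar>Im w\<bar>)"
  proof -
    have "- (Im w * Im (Ln z)) \<le> \<bar>Im w\<bar> * \<bar>Im (Ln z)\<bar>" by (metis abs_ge_minus_self abs_mult)
    also have "\<dots> \<le> \<bar>Im w\<bar> * (pi / 2)" using arg by (intro mult_left_mono) auto
    finally show ?thesis by (intro mult_left_mono) (auto simp: mult.commute)
  qed
  finally show ?thesis .
qed

text \<open>As Re s - 1 is nonpositive, the modulus of z may be replaced by a lower bound r. The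
  factor exp (- Re z) is kept for the contour far from the origin.\<close>

lemma gamma_integrand_bound:
  assumes z: "z \<noteq> 0" "Re z \<ge> 0" and r: "0 < r" "r \<le> cmod z" and s: "Re s \<le> 1"
  shows "cmod (z powr (s - 1) * exp (- z)) \<le> exp (pi / 2 * \<bar>Im s\<bar>) * r powr (Re s - 1) * exp (- Re z)"
proof -
  have "cmod (z powr (s - 1)) \<le> cmod z powr (Re s - 1) * exp (pi / 2 * \<bar>Im s\<bar>)"
    using norm_powr_le_right_half_plane[OF z, of "s - 1"] by simp
  also have "\<dots> \<le> r powr (Re s - 1) * exp (pi / 2 * \<bar>Im s\<bar>)"
    using r s by (intro mult_right_mono powr_mono2') auto
  finally show ?thesis
    by (simp add: norm_mult mult.commute mult_left_mono)
qed

lemma tendsto_incomplete_gamma: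
  assumes "Re s > 0"
  shows "((\<lambda>x. integral {0..x} (\<lambda>t. of_real t powr (s - 1) * exp (- of_real t))) \<longlongrightarrow> Gamma s) at_top"
proof -
  have lim: "((\<lambda>x. \<integral>t. indicator {..x} t *\<^sub>R gamma_kernel s t \<partial>lborel) \<longlongrightarrow> Gamma s) at_top"
    using tendsto_integral_at_top[OF _ integrable_gamma_kernel[OF assms]] integral_gamma_kernel[OF assms] by simp
  have "(\<integral>t. indicator {..x} t *\<^sub>R gamma_kernel s t \<partial>lborel) =
      integral {0..x} (\<lambda>t. of_real t powr (s - 1) * exp (- of_real t))" for x
  proof -
    have i: "set_integrable lborel {..x} (gamma_kernel s)"
      by (rule set_integrable_subset[of _ UNIV]) 
        (use integrable_gamma_kernel[OF assms] in \<open>auto simp: set_integrable_def\<close>)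
    have "(\<integral>t. indicator {..x} t *\<^sub>R gamma_kernel s t \<partial>lborel) = integral {..x} (gamma_kernel s)"
      using set_borel_integral_eq_integral(2)[OF i] by (simp add: set_lebesgue_integral_def)
    also have "\<dots> = integral {0..x} (\<lambda>t. of_real t powr (s - 1) * exp (- of_real t))"
    proof -
      have "gamma_kernel s = (\<lambda>t. if t \<in> {0..} then of_real t powr (s - 1) * exp (- of_real t) else 0)"
        by (auto simp: gamma_kernel_def indicator_def fun_eq_iff exp_minus field_simps exp_of_real)
      then have "integral {..x} (gamma_kernel s) =
          integral {..x} (\<lambda>t. if t \<in> {0..} then of_real t powr (s - 1) * exp (- of_real t) else 0)"
        by simp
      also have "\<dots> = integral ({0..} \<inter> {..x}) (\<lambda>t. of_real t powr (s - 1) * exp (- of_real t))"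
        using Henstock_Kurzweil_Integration.integral_restrict_Int[of "{..x}" "{0..}" "\<lambda>t. of_real t powr (s - 1) * exp (- complex_of_real t)"]
        by (simp add: Int_commute)
      also have "{0..} \<inter> {..x} = {0..x}" by auto
      finally show ?thesis .
    qed
    finally show ?thesis .
  qed
  with lim show ?thesis by simp
qed

lemma integrable_powr_from_0_complex:
  assumes "Re s > 0" and [continuous_intros]: "continuous_on {0..b} f"
  shows "(\<lambda>t. of_real t powr (s - 1) * f t) absolutely_integrable_on {0..b}"
proof (cases "b > 0")
  case True
  have "bounded (f ` {0..b})"
    using assms by (simp add: compact_continuous_image compact_imp_bounded)
  then obtain C where C: "\<And>t. t \<in> {0..b} \<Longrightarrow> cmod (f t) \<le> C" by (auto simp: bounded_iff simp del: atLeastAtMost_iff)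
  have cp: "continuous_on {0<..b} (\<lambda>t. complex_of_real t powr (s - 1))"
    by (intro continuous_intros) (auto simp: complex_nonpos_Reals_iff)
  have "(\<lambda>t. of_real t powr (s - 1) * f t) absolutely_integrable_on {0<..b}"
  proof (rule measurable_bounded_by_integrable_imp_absolutely_integrable)
    show "(\<lambda>t. of_real t powr (s - 1) * f t) \<in> borel_measurable (lebesgue_on {0<..b})"
      by (intro continuous_imp_measurable_on_sets_lebesgue continuous_on_mult cp continuous_on_subset[OF assms(2)]) auto
    show "(\<lambda>t. C * t powr (Re s - 1)) integrable_on {0<..b}"
      using assms True by (intro integrable_on_mult_right integrable_on_powr_from_0') auto
    show "cmod (of_real t powr (s - 1) * f t) \<le> C * t powr (Re s - 1)" if "t \<in> {0<..b}" for t
      using that C[of t] by (simp add: norm_mult norm_powr_pos mult.commute mult_right_mono)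
  qed auto
  then show ?thesis
    by (rule absolutely_integrable_spike_set) (auto intro: negligible_subset[of "{0}"])
next
  case False
  then have n: "negligible {0..b}"
    by (intro negligible_subset[OF negligible_sing[of 0]]) auto
  have "(\<lambda>_. 0 :: complex) absolutely_integrable_on {0..b}" by simp
  then show ?thesis
    by (rule absolutely_integrable_spike[OF _ n]) simp
qed

text \<open>Cauchy's theorem, in the form of a primitive on the slit plane, turns the positive real axis into the positive
  imaginary one; the connecting pieces vanish because \<open>0 < Re s < 1\<close>.\<close>

lemma tendsto_oscillatory_gamma:
  assumes s: "0 < Re s" "Re s < 1"
  shows "((\<lambda>x. integral {0..x} (\<lambda>t. of_real t powr (s - 1) * exp (- (\<i> * of_real t))))
    \<longlongrightarrow> Gamma s * exp (- (\<i> * of_real pi / 2 * s))) at_top"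
proof -
  define f where "f z = z powr (s - 1) * exp (- z)" for z :: complex
  define S where "S = - (complex_of_real ` {..0})"
  have S: "z \<in> S \<longleftrightarrow> z \<notin> \<real>\<^sub>\<le>\<^sub>0" for z
    by (auto simp: S_def nonpos_Reals_def)
  have df: "f field_differentiable at z" if "z \<in> S" for z
    using that unfolding f_def S field_differentiable_def
    by (auto intro!: derivative_eq_intros exI)
  have "\<exists>F. \<forall>z\<in>S. (F has_field_derivative f z) (at z)"
  proof (rule holomorphic_starlike_primitive[of _ _ "{}"])
    show "continuous_on S f"
      using df by (simp add: continuous_at_imp_continuous_on field_differentiable_imp_continuous_at)
    show "open S" unfolding S_def by (intro open_Compl closed_slot_left)
    show "starlike S" unfolding S_def by (rule starlike_slotted_complex_plane_left)
  qed (use df in auto)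
  then obtain F where F: "\<And>z. z \<in> S \<Longrightarrow> (F has_field_derivative f z) (at z)" by blast
  define c where "c = exp (\<i> * of_real pi / 2 * s)"
  define a where "a t = complex_of_real t powr (s - 1) * exp (- of_real t)" for t
  define b where "b t = complex_of_real t powr (s - 1) * exp (- (\<i> * of_real t))" for t
  have inS: "z \<in> S" if "Re z \<ge> 0" "z \<noteq> 0" for z
    using that unfolding S by (auto simp: complex_nonpos_Reals_iff complex_eq_iff)
  \<comment> \<open>Parametrizing the imaginary axis by z = i * t produces i * i powr (s - 1) = i
    powr s, which is \<open>c\<close>.\<close>
  have fi: "\<i> * f (\<i> * of_real t) = c * b t" if "t > 0" for t
  proof -
    have "(\<i> * of_real t) powr (s - 1) = \<i> powr (s - 1) * of_real t powr (s - 1)"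
      using powr_times_real_left[of "of_real t" \<i> "s - 1"] that by (simp add: mult.commute)
    moreover have "\<i> * \<i> powr (s - 1) = c"
    proof -
      have "\<i> * \<i> powr (s - 1) = \<i> powr (1 + (s - 1))" by (subst powr_add) simp
      also have "\<dots> = c" by (simp add: c_def powr_def mult.commute mult.left_commute)
      finally show ?thesis .
    qed
    ultimately show ?thesis by (simp add: f_def b_def mult.assoc [symmetric])
  qed
  have ai: "a integrable_on {0..x}" and bi: "b integrable_on {0..x}" for x
    unfolding a_def b_def using s(1)
    by (intro set_lebesgue_integral_eq_integral(1) integrable_powr_from_0_complex continuous_intros; simp)+
  have Fr: "integral {0..y} a - integral {0..x} a = F (of_real y) - F (of_real x)"
    and Fim: "c * integral {0..y} b - c * integral {0..x} b = F (\<i> * of_real y) - F (\<i> * of_real x)"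
    if "0 < x" "x \<le> y" for x y
  proof -
    have "(a has_integral F (of_real y) - F (of_real x)) {x..y}"
    proof (rule fundamental_theorem_of_calculus)
      fix t assume t: "t \<in> {x..y}"
      then have "(F has_field_derivative f (of_real t)) (at (of_real t))"
        using that by (intro F inS) auto
      then show "((\<lambda>t. F (of_real t)) has_vector_derivative a t) (at t within {x..y})"
        unfolding a_def f_def by (rule has_vector_derivative_real_field)
    qed (use that in auto)
    moreover have "integral {0..y} a = integral {0..x} a + integral {x..y} a"
      using that by (intro Henstock_Kurzweil_Integration.integral_combine[symmetric] ai) auto
    ultimately show "integral {0..y} a - integral {0..x} a = F (of_real y) - F (of_real x)"
      by (simp add: integral_unique)
    have "((\<lambda>t. c * b t) has_integral F (\<i> * of_real y) - F (\<i> * of_real x)) {x..y}"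
    proof (rule fundamental_theorem_of_calculus)
      fix t assume t: "t \<in> {x..y}"
      have "(F has_field_derivative f (\<i> * of_real t)) (at (\<i> * of_real t))"
        using that t by (intro F inS) auto
      then have "(F \<circ> (\<lambda>t. \<i> * of_real t) has_vector_derivative \<i> * f (\<i> * of_real t)) (at t within {x..y})"
        by (intro field_vector_diff_chain_within)
          (auto intro!: derivative_eq_intros simp: has_field_derivative_at_within)
      then show "((\<lambda>t. F (\<i> * of_real t)) has_vector_derivative c * b t) (at t within {x..y})"
        using fi[of t] t that by (simp add: o_def)
    qed (use that in auto)
    then have "c * integral {x..y} b = F (\<i> * of_real y) - F (\<i> * of_real x)"
      by (metis integral_mult_right integral_unique)
    moreover have "integral {0..y} b = integral {0..x} b + integral {x..y} b"
      using that by (intro Henstock_Kurzweil_Integration.integral_combine[symmetric] bi) auto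
    ultimately show "c * integral {0..y} b - c * integral {0..x} b = F (\<i> * of_real y) - F (\<i> * of_real x)"
      by (simp add: algebra_simps)
  qed
  define K where "K = exp (pi / 2 * \<bar>Im s\<bar>)"
  \<comment> \<open>\<open>D x\<close> measures the failure of the contour 0, x, i * x, 0 to close
    up. It does not depend on x, so its limit at 0 shows that it vanishes.\<close>
  define D where "D x = (integral {0..x} a - c * integral {0..x} b) - (F (of_real x) - F (\<i> * of_real x))" for x
  have D_const: "D x = D y" if "0 < x" "x \<le> y" for x y
  proof -
    have "D y - D x = (integral {0..y} a - integral {0..x} a) - (c * integral {0..y} b - c * integral {0..x} b)
        - ((F (of_real y) - F (of_real x)) - (F (\<i> * of_real y) - F (\<i> * of_real x)))"
      by (simp add: D_def algebra_simps)
    also have "\<dots> = 0" unfolding Fr[OF that] Fim[OF that] by simp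
    finally show ?thesis by simp
  qed
  \<comment> \<open>Near 0 the straight chord suffices: on it one of the two coordinates is at least
    x / 2, and its length is at most 2 * x, which gives O(x powr Re s).\<close>
  have small: "cmod (F (of_real x) - F (\<i> * of_real x)) \<le> 4 * K * (x / 2) powr Re s" if "x > 0" for x
  proof -
    have seg: "x / 2 \<le> cmod z \<and> Re z \<ge> 0" if "z \<in> closed_segment (of_real x) (\<i> * of_real x)" for z
    proof -
      from that obtain u where u: "0 \<le> u" "u \<le> 1" "z = (1 - u) *\<^sub>R of_real x + u *\<^sub>R (\<i> * of_real x)"
        unfolding closed_segment_def by blast
      have "x / 2 \<le> max (Re z) (Im z)"
      proof (cases "u \<le> 1 / 2")
        case True
        then have "x * (1 / 2) \<le> x * (1 - u)" using \<open>x > 0\<close> by (intro mult_left_mono) auto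
        moreover have "Re z = (1 - u) * x" "Im z = u * x" unfolding u(3) by simp_all
        ultimately have "x / 2 \<le> Re z" by (simp add: mult.commute)
        then show ?thesis by (rule order_trans) simp
      next
        case False
        then have "x * (1 / 2) \<le> x * u" using \<open>x > 0\<close> by (intro mult_left_mono) auto
        moreover have "Re z = (1 - u) * x" "Im z = u * x" unfolding u(3) by simp_all
        ultimately have "x / 2 \<le> Im z" by (simp add: mult.commute)
        then show ?thesis by (rule order_trans) simp
      qed
      also have "\<dots> \<le> cmod z" using complex_Re_le_cmod[of z] abs_Im_le_cmod[of z] by auto
      finally have "x / 2 \<le> cmod z" .
      moreover have "Re z = (1 - u) * x" unfolding u(3) by simp
      ultimately show ?thesis using u(1,2) \<open>x > 0\<close> by simp
    qed
    have "cmod (F (of_real x) - F (\<i> * of_real x)) \<le> (K * (x / 2) powr (Re s - 1)) * cmod (of_real x - \<i> * of_real x)"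
    proof (rule field_differentiable_bound[where S = "closed_segment (of_real x) (\<i> * of_real x)" and f' = f])
      fix z assume z: "z \<in> closed_segment (of_real x) (\<i> * of_real x)"
      have z': "x / 2 \<le> cmod z" "Re z \<ge> 0" using seg[OF z] by simp_all
      then have "cmod z > 0" using that by linarith
      with z' have z': "x / 2 \<le> cmod z" "Re z \<ge> 0" "z \<noteq> 0" by auto
      show "(F has_field_derivative f z) (at z within closed_segment (of_real x) (\<i> * of_real x))"
        using z' by (auto intro!: has_field_derivative_at_within[OF F[OF inS]])
      have "cmod (f z) \<le> K * (x / 2) powr (Re s - 1) * exp (- Re z)"
        unfolding f_def K_def using z' that s by (intro gamma_integrand_bound) auto
      also have "\<dots> \<le> K * (x / 2) powr (Re s - 1) * 1"
        using z' by (intro mult_left_mono) (auto simp: K_def)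
      finally show "cmod (f z) \<le> K * (x / 2) powr (Re s - 1)" by simp
    qed auto
    also have "\<dots> \<le> (K * (x / 2) powr (Re s - 1)) * (4 * (x / 2))"
    proof (intro mult_left_mono)
      have "cmod (of_real x - \<i> * of_real x) \<le> cmod (of_real x) + cmod (\<i> * of_real x)"
        by (rule norm_triangle_ineq4)
      then show "cmod (of_real x - \<i> * of_real x) \<le> 4 * (x / 2)" using that by (simp add: norm_mult)
    qed (auto simp: K_def)
    also have "\<dots> = 4 * K * ((x / 2) powr (Re s - 1) * (x / 2) powr 1)" using that by simp
    also have "\<dots> = 4 * K * (x / 2) powr Re s" by (subst powr_add[symmetric]) simp
    finally show ?thesis .
  qed
  \<comment> \<open>For large x the path goes through the corner x + i * x. The vertical leg is
    damped by exp (- x); on the horizontal leg exp (- t) integrates to at most 1, leaving x powr (Re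
    s - 1), which vanishes because Re s < 1.\<close>
  have large: "cmod (F (of_real x) - F (\<i> * of_real x)) \<le> K * (x powr Re s * exp (- x)) + K * x powr (Re s - 1)"
    if "x > 0" for x
  proof -
    let ?w = "Complex x x"
    have "cmod (F (of_real x) - F ?w) \<le> (K * x powr (Re s - 1) * exp (- x)) * cmod (of_real x - ?w)"
    proof (rule field_differentiable_bound[where S = "closed_segment (of_real x) ?w" and f' = f])
      fix z assume "z \<in> closed_segment (of_real x) ?w"
      then have z: "Re z = x"
        unfolding closed_segment_def by clarsimp (simp add: left_diff_distrib)
      then have z': "x \<le> cmod z" "Re z \<ge> 0" "z \<noteq> 0"
        using that complex_Re_le_cmod[of z] by auto
      show "(F has_field_derivative f z) (at z within closed_segment (of_real x) ?w)"
        using z' by (auto intro!: has_field_derivative_at_within[OF F[OF inS]])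
      show "cmod (f z) \<le> K * x powr (Re s - 1) * exp (- x)"
        using gamma_integrand_bound[of z x s] z z' that s unfolding f_def K_def by auto
    qed auto
    also have "of_real x - ?w = - (\<i> * of_real x)" by (simp add: complex_eq_iff)
    also have "(K * x powr (Re s - 1) * exp (- x)) * cmod (- (\<i> * of_real x)) = K * ((x powr (Re s - 1) * x powr 1) * exp (- x))"
      using that by (simp add: norm_mult)
    also have "x powr (Re s - 1) * x powr 1 = x powr Re s" by (subst powr_add[symmetric]) simp
    finally have 1: "cmod (F (of_real x) - F ?w) \<le> K * (x powr Re s * exp (- x))" .
    have "((\<lambda>t. f (of_real t + \<i> * of_real x)) has_integral F (of_real x + \<i> * of_real x) - F (of_real 0 + \<i> * of_real x)) {0..x}"
    proof (rule fundamental_theorem_of_calculus)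
      fix t assume t: "t \<in> {0..x}"
      have "(F has_field_derivative f (of_real t + \<i> * of_real x)) (at (of_real t + \<i> * of_real x))"
        using that t by (intro F inS) (auto simp: complex_eq_iff)
      then have "(F \<circ> (\<lambda>t. of_real t + \<i> * of_real x) has_vector_derivative 1 * f (of_real t + \<i> * of_real x)) (at t within {0..x})"
        by (intro field_vector_diff_chain_within)
          (auto intro!: derivative_eq_intros simp: has_field_derivative_at_within)
      then show "((\<lambda>t. F (of_real t + \<i> * of_real x)) has_vector_derivative f (of_real t + \<i> * of_real x)) (at t within {0..x})"
        by (simp add: o_def)
    qed (use that in auto)
    moreover have "of_real x + \<i> * of_real x = ?w" by (simp add: complex_eq_iff)
    ultimately have int: "((\<lambda>t. f (of_real t + \<i> * of_real x)) has_integral F ?w - F (\<i> * of_real x)) {0..x}"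
      by simp
    have int2: "((\<lambda>t. K * x powr (Re s - 1) * exp (- t)) has_integral K * x powr (Re s - 1) * (- exp (- x) - - exp (- 0))) {0..x}"
      by (intro has_integral_mult_right fundamental_theorem_of_calculus)
        (use that in \<open>auto intro!: derivative_eq_intros simp: has_real_derivative_iff_has_vector_derivative[symmetric]\<close>)
    have "cmod (F ?w - F (\<i> * of_real x)) \<le> K * x powr (Re s - 1) * (- exp (- x) - - exp (- 0))"
      unfolding integral_unique[OF int, symmetric] integral_unique[OF int2, symmetric]
    proof (rule integral_norm_bound_integral[OF has_integral_integrable[OF int] has_integral_integrable[OF int2]])
      fix t assume t: "t \<in> {0..x}"
      have "x \<le> cmod (of_real t + \<i> * of_real x)"
        using abs_Im_le_cmod[of "of_real t + \<i> * of_real x"] that by simp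
      then show "cmod (f (of_real t + \<i> * of_real x)) \<le> K * x powr (Re s - 1) * exp (- t)"
        using gamma_integrand_bound[of "of_real t + \<i> * of_real x" x s] t that s unfolding f_def K_def
        by (auto simp: complex_eq_iff)
    qed
    also have "\<dots> \<le> K * x powr (Re s - 1) * 1" by (intro mult_left_mono) (auto simp: K_def)
    finally have 2: "cmod (F ?w - F (\<i> * of_real x)) \<le> K * x powr (Re s - 1)" by simp
    show ?thesis using norm_triangle_ineq[of "F (of_real x) - F ?w" "F ?w - F (\<i> * of_real x)"] 1 2 by simp
  qed
  have lim0: "((\<lambda>x. F (of_real x) - F (\<i> * of_real x)) \<longlongrightarrow> 0) (at_right 0)"
  proof (rule Lim_null_comparison)
    show "\<forall>\<^sub>F x in at_right 0. cmod (F (of_real x) - F (\<i> * of_real x)) \<le> 4 * K * (x / 2) powr Re s"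
      by (auto simp: eventually_at_filter intro!: always_eventually small)
    have "((\<lambda>x::real. 4 * K * (x / 2) powr Re s) \<longlongrightarrow> 4 * K * (0 / 2) powr Re s) (at_right 0)"
      using s by (intro tendsto_mult tendsto_const tendsto_powr2 tendsto_divide tendsto_ident_at)
         (auto simp: eventually_at_filter intro!: always_eventually)
    then show "((\<lambda>x::real. 4 * K * (x / 2) powr Re s) \<longlongrightarrow> 0) (at_right 0)" by simp
  qed
  have int0: "((\<lambda>x. integral {0..x} g) \<longlongrightarrow> 0) (at_right 0)" if "g integrable_on {0..1}" for g :: "real \<Rightarrow> complex"
  proof -
    have "((\<lambda>x. integral {0..x} g) \<longlongrightarrow> integral {0..0} g) (at 0 within {0..1})"
      using indefinite_integral_continuous_1[OF that] unfolding continuous_on_def by (rule bspec) simp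
    then show ?thesis by (simp add: at_within_Icc_at_right)
  qed
  have "(D \<longlongrightarrow> 0) (at_right 0)"
    unfolding D_def using tendsto_diff[OF tendsto_diff[OF int0[OF ai] tendsto_mult[OF tendsto_const[of c] int0[OF bi]]] lim0] by simp
  moreover have "\<forall>\<^sub>F x in at_right 0. D x = D 1"
    using eventually_at_right_real[OF zero_less_one] by eventually_elim (auto intro: D_const)
  ultimately have "((\<lambda>_. D 1) \<longlongrightarrow> 0) (at_right (0::real))"
    by (rule Lim_transform_eventually)
  then have "D 1 = 0"
    using tendsto_const_iff[of "at_right (0::real)" "D 1" 0] by simp
  then have D0: "D x = 0" if "x \<ge> 1" for x using D_const[of 1 x] that by simp
  have liminf: "((\<lambda>x. F (of_real x) - F (\<i> * of_real x)) \<longlongrightarrow> 0) at_top"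
  proof (rule Lim_null_comparison)
    show "\<forall>\<^sub>F x in at_top. cmod (F (of_real x) - F (\<i> * of_real x)) \<le> K * (x powr Re s * exp (- x)) + K * x powr (Re s - 1)"
      using eventually_gt_at_top[of 0] by eventually_elim (rule large)
    have "((\<lambda>x. x powr Re s * exp (- x)) \<longlongrightarrow> 0) at_top" by real_asymp
    moreover have "((\<lambda>x. x powr (Re s - 1)) \<longlongrightarrow> 0) at_top"
      using s by (intro tendsto_neg_powr filterlim_ident) auto
    ultimately show "((\<lambda>x. K * (x powr Re s * exp (- x)) + K * x powr (Re s - 1)) \<longlongrightarrow> 0) at_top"
      using tendsto_add[OF tendsto_mult[OF tendsto_const[of K]] tendsto_mult[OF tendsto_const[of K]]] by fastforce
  qed
  have "((\<lambda>x. (integral {0..x} a - (F (of_real x) - F (\<i> * of_real x))) / c) \<longlongrightarrow> (Gamma s - 0) / c) at_top"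
    unfolding a_def using s by (intro tendsto_intros tendsto_incomplete_gamma liminf) (auto simp: c_def)
  moreover have "\<forall>\<^sub>F x in at_top. (integral {0..x} a - (F (of_real x) - F (\<i> * of_real x))) / c = integral {0..x} b"
    using eventually_ge_at_top[of 1]
  proof eventually_elim
    case (elim x)
    then show ?case using D0[of x] by (simp add: D_def c_def field_simps)
  qed
  ultimately have "((\<lambda>x. integral {0..x} b) \<longlongrightarrow> (Gamma s - 0) / c) at_top"
    by (rule Lim_transform_eventually)
  moreover have "inverse c = exp (- (\<i> * of_real pi / 2 * s))"
    by (simp only: c_def exp_minus)
  ultimately show ?thesis by (simp only: diff_0_right divide_inverse b_def[abs_def])
qed
section \<open>Incomplete Euler integrals\<close>

definition jacobi_weight :: "complex \<Rightarrow> complex \<Rightarrow> real \<Rightarrow> complex" where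
  "jacobi_weight p q v = of_real (1 - v) powr (p - 1) * of_real (1 + v) powr (q - 1)"

text \<open>The n-th moment in v, hence the n-th derivative in z, of half of Kummer's integral over
  -1..1. The half kept has its singularity at v = 1.\<close>

definition jacobi_exp :: "complex \<Rightarrow> complex \<Rightarrow> nat \<Rightarrow> complex \<Rightarrow> complex" where
  "jacobi_exp p q n z = integral {0..1} (\<lambda>v. of_real v ^ n * exp (z * of_real v) * jacobi_weight p q v)"

context
  fixes p q :: complex
  assumes p: "Re p > 0"
begin

text \<open>The factor 1 + v stays between 1 and 2, so the only singular point is v = 1; the
  reflection v = 1 - t moves it to 0.\<close>

lemma absolutely_integrable_jacobi_weight:
  assumes f: "continuous_on {0..1} f"
  shows "(\<lambda>v. f v * jacobi_weight p q v) absolutely_integrable_on {0..1}"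
proof -
  have "(\<lambda>t. of_real t powr (p - 1) * (of_real (2 - t) powr (q - 1) * f (1 - t))) absolutely_integrable_on {0..1}"
    by (intro integrable_powr_from_0_complex p continuous_on_mult continuous_on_of_real_powr
        continuous_intros continuous_on_compose2[OF f]) auto
  then have "((\<lambda>v. f v * jacobi_weight p q v) \<circ> (\<lambda>t. 1 - t)) absolutely_integrable_on {0..1}"
    by (rule absolutely_integrable_spike[OF _ negligible_empty]) (simp add: jacobi_weight_def algebra_simps)
  then have "(\<lambda>t. \<bar>-1\<bar> *\<^sub>R (f (1 - t) * jacobi_weight p q (1 - t))) absolutely_integrable_on {0..1}"
    by (simp add: o_def)
  then have "(\<lambda>v. f v * jacobi_weight p q v) absolutely_integrable_on ((\<lambda>t. 1 - t) ` {0..1})"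
    by (rule absolutely_integrable_change_of_variables_real[THEN iffD2, rotated 3])
      (auto intro!: derivative_eq_intros inj_onI)
  moreover have "(\<lambda>t. 1 - t) ` {0..1} = {0..1::real}"
    by (auto simp: image_iff intro!: bexI[of _ "1 - _"])
  ultimately show ?thesis by simp
qed

lemma integrable_jacobi_exp:
  "(\<lambda>v. of_real v ^ n * exp (z * of_real v) * jacobi_weight p q v) integrable_on {0..1}"
  by (intro set_lebesgue_integral_eq_integral(1) absolutely_integrable_jacobi_weight continuous_intros)

lemma integrable_norm_jacobi_weight: "(\<lambda>v. cmod (jacobi_weight p q v)) integrable_on {0..1}"
  using absolutely_integrable_jacobi_weight[of "\<lambda>_. 1"]
  by (simp add: absolutely_integrable_on_def)

text \<open>Integrates the derivative of \<open>v ^ n * exp (z * v) * (1 - v) powr p * (1 + v) powr q\<close>.\<close>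
lemma jacobi_exp_recurrence:
  "of_nat n * (jacobi_exp p q (n - 1) z - jacobi_exp p q (Suc n) z) +
   z * (jacobi_exp p q n z - jacobi_exp p q (n + 2) z) -
   (p - q) * jacobi_exp p q n z - (p + q) * jacobi_exp p q (Suc n) z = (if n = 0 then - 1 else 0)"
proof -
  define G where "G v = of_real v ^ n * exp (z * of_real v) * (of_real (1 - v) powr p * of_real (1 + v) powr q)" for v
  let ?e = "\<lambda>k v. of_real v ^ k * exp (z * of_real v) * jacobi_weight p q v"
  \<comment> \<open>For n = 0 the truncated exponent \<open>n - 1\<close> is harmless because of the
    factor \<open>of_nat n\<close>.\<close>
  define G' where "G' v = of_nat n * (?e (n - 1) v - ?e (Suc n) v) + z * (?e n v - ?e (n + 2) v)
    - (p - q) * ?e n v - (p + q) * ?e (Suc n) v" for v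
  have "(G' has_integral G 1 - G 0) {0..1}"
  proof (rule fundamental_theorem_of_calculus_interior)
    show "continuous_on {0..1} G"
      unfolding G_def using p
      by (intro continuous_intros continuous_on_of_real_powr continuous_on_powr_complex) auto
    fix v :: real assume v: "v \<in> {0<..<1}"
    have np: "complex_of_real (1 - v) \<notin> \<real>\<^sub>\<le>\<^sub>0" "complex_of_real (1 + v) \<notin> \<real>\<^sub>\<le>\<^sub>0"
      using v by (auto simp: complex_nonpos_Reals_iff)
    \<comment> \<open>Splitting off one factor from each power turns (1 - v) powr p * (1 + v) powr q
      into (1 - v^2) times the weight, so every term of the derivative is a moment.\<close>
    have pw: "complex_of_real (1 - v) powr p = of_real (1 - v) powr (p - 1) * (1 - of_real v)"
         "complex_of_real (1 + v) powr q = of_real (1 + v) powr (q - 1) * (1 + of_real v)"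
      using v powr_add[of "complex_of_real (1 - v)" "p - 1" 1] powr_add[of "complex_of_real (1 + v)" "q - 1" 1]
      by (auto simp: complex_eq_iff)
    have "((\<lambda>w. w ^ n * exp (z * w) * ((1 - w) powr p * (1 + w) powr q)) has_field_derivative
       of_nat n * of_real v ^ (n - 1) * exp (z * of_real v) * (of_real (1 - v) powr p * of_real (1 + v) powr q)
       + z * of_real v ^ n * exp (z * of_real v) * (of_real (1 - v) powr p * of_real (1 + v) powr q)
       + of_real v ^ n * exp (z * of_real v) * (- p * of_real (1 - v) powr (p - 1) * of_real (1 + v) powr q
          + q * of_real (1 - v) powr p * of_real (1 + v) powr (q - 1))) (at (of_real v))"
      using np by (auto intro!: derivative_eq_intros simp: algebra_simps)
    then have "(G has_vector_derivative
       of_nat n * of_real v ^ (n - 1) * exp (z * of_real v) * (of_real (1 - v) powr p * of_real (1 + v) powr q)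
       + z * of_real v ^ n * exp (z * of_real v) * (of_real (1 - v) powr p * of_real (1 + v) powr q)
       + of_real v ^ n * exp (z * of_real v) * (- p * of_real (1 - v) powr (p - 1) * of_real (1 + v) powr q
          + q * of_real (1 - v) powr p * of_real (1 + v) powr (q - 1))) (at v)"
      by (drule_tac has_vector_derivative_real_field[where s = UNIV]) (simp add: G_def[abs_def])
    also have "of_nat n * of_real v ^ (n - 1) * exp (z * of_real v) * (of_real (1 - v) powr p * of_real (1 + v) powr q)
       + z * of_real v ^ n * exp (z * of_real v) * (of_real (1 - v) powr p * of_real (1 + v) powr q)
       + of_real v ^ n * exp (z * of_real v) * (- p * of_real (1 - v) powr (p - 1) * of_real (1 + v) powr q
          + q * of_real (1 - v) powr p * of_real (1 + v) powr (q - 1)) = G' v"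
      unfolding G'_def jacobi_weight_def pw
      by (cases n) (simp_all add: algebra_simps power2_eq_square)
    finally show "(G has_vector_derivative G' v) (at v)" .
  qed auto
  moreover have "(G' has_integral of_nat n * (jacobi_exp p q (n - 1) z - jacobi_exp p q (Suc n) z) +
     z * (jacobi_exp p q n z - jacobi_exp p q (n + 2) z) -
     (p - q) * jacobi_exp p q n z - (p + q) * jacobi_exp p q (Suc n) z) {0..1}"
    unfolding G'_def jacobi_exp_def
    by (intro has_integral_add has_integral_diff has_integral_mult_right integrable_integral integrable_jacobi_exp)
  ultimately have "of_nat n * (jacobi_exp p q (n - 1) z - jacobi_exp p q (Suc n) z) +
     z * (jacobi_exp p q n z - jacobi_exp p q (n + 2) z) -
     (p - q) * jacobi_exp p q n z - (p + q) * jacobi_exp p q (Suc n) z = G 1 - G 0"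
    by (rule has_integral_unique[rotated])
  \<comment> \<open>The factor (1 - v) powr p vanishes at v = 1; at v = 0 the factor v ^ n survives
    only for n = 0. This -1 is the source of the inhomogeneity in the differential equation.\<close>
  also have "G 1 - G 0 = (if n = 0 then - 1 else 0)"
    by (auto simp: G_def)
  finally show ?thesis .
qed

text \<open>The exponential series may be integrated termwise: since 0 <= v <= 1, its partial sums
  are dominated by exp (cmod z). The Taylor coefficients become moments at z = 0, which can be
  compared with the coefficients of the Weber solutions.\<close>

lemma jacobi_exp_sums:
  "(\<lambda>m. jacobi_exp p q (n + m) 0 / fact m * z ^ m) sums jacobi_exp p q n z"
proof -
  let ?g = "\<lambda>v. of_real v ^ n * exp (z * of_real v) * jacobi_weight p q v"
  let ?f = "\<lambda>k v. \<Sum>m<k. z ^ m / fact m * (of_real v ^ (n + m) * exp (0 * of_real v) * jacobi_weight p q v)"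
  have "(\<lambda>k. integral {0..1} (?f k)) \<longlonglongrightarrow> integral {0..1} ?g"
  proof (rule dominated_convergence(2))
    show "?f k integrable_on {0..1}" for k
      by (intro integrable_sum integrable_on_mult_right integrable_jacobi_exp) auto
    show "(\<lambda>v. exp (cmod z) * cmod (jacobi_weight p q v)) integrable_on {0..1}"
      by (intro integrable_on_mult_right integrable_norm_jacobi_weight)
    show "cmod (?f k v) \<le> exp (cmod z) * cmod (jacobi_weight p q v)" if "v \<in> {0..1}" for k v
    proof -
      have "cmod (\<Sum>m<k. z ^ m / fact m * of_real v ^ (n + m)) \<le> (\<Sum>m<k. cmod z ^ m / fact m)"
      proof (rule order_trans[OF norm_sum], rule sum_mono)
        fix m
        have "v ^ (n + m) \<le> 1" using that by (simp add: power_le_one)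
        then have "cmod z ^ m / fact m * v ^ (n + m) \<le> cmod z ^ m / fact m * 1"
          by (intro mult_left_mono) auto
        then show "cmod (z ^ m / fact m * of_real v ^ (n + m)) \<le> cmod z ^ m / fact m"
          using that by (simp add: norm_mult norm_divide norm_power)
      qed
      also have "\<dots> \<le> exp (cmod z)"
        using sum_le_suminf[OF summable_exp_generic[of "cmod z"], of "{..<k}"]
        by (simp add: exp_def divide_inverse mult.commute)
      finally have "cmod (\<Sum>m<k. z ^ m / fact m * of_real v ^ (n + m)) * cmod (jacobi_weight p q v)
          \<le> exp (cmod z) * cmod (jacobi_weight p q v)" by (rule mult_right_mono) simp
      then show ?thesis by (simp add: sum_distrib_right mult.assoc norm_mult[symmetric])
    qed
    show "(\<lambda>k. ?f k v) \<longlonglongrightarrow> ?g v" for v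
    proof -
      have "(\<lambda>m. of_real v ^ n * ((z * of_real v) ^ m /\<^sub>R fact m) * jacobi_weight p q v) sums ?g v"
        by (intro sums_mult sums_mult2 exp_converges)
      then show ?thesis
        unfolding sums_def
        by (simp add: scaleR_conv_of_real power_add power_mult_distrib divide_inverse mult_ac)
    qed
  qed
  moreover have "integral {0..1} (?f k) = (\<Sum>m<k. jacobi_exp p q (n + m) 0 / fact m * z ^ m)" for k
    unfolding jacobi_exp_def
    by (subst integral_sum)
      (auto intro!: integrable_on_mult_right integrable_jacobi_exp[of _ 0, simplified] sum.cong)
  ultimately show ?thesis by (simp add: sums_def jacobi_exp_def)
qed

lemma has_field_derivative_jacobi_exp:
  "(jacobi_exp p q n has_field_derivative jacobi_exp p q (Suc n) z) (at z)"
proof -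
  let ?c = "\<lambda>m. jacobi_exp p q (n + m) 0 / fact m"
  have "((\<lambda>z. \<Sum>m. ?c m * z ^ m) has_field_derivative (\<Sum>m. diffs ?c m * z ^ m)) (at z)"
    by (rule termdiffs_strong_converges_everywhere) (use jacobi_exp_sums sums_summable in blast)
  moreover have "diffs ?c m = jacobi_exp p q (Suc n + m) 0 / fact m" for m
    by (simp add: diffs_def field_simps del: of_nat_Suc)
  moreover have "(\<lambda>z. \<Sum>m. ?c m * z ^ m) = jacobi_exp p q n"
    using jacobi_exp_sums by (auto simp: sums_iff fun_eq_iff)
  ultimately show ?thesis
    using jacobi_exp_sums[of "Suc n" z] by (simp add: sums_iff)
qed

end

section \<open>Endpoint asymptotics of oscillatory integrals\<close>

lemma continuous_on_difference_quotient:
  fixes f :: "real \<Rightarrow> complex"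
  assumes f: "\<And>u. u \<in> {0..1} \<Longrightarrow> (f has_vector_derivative f' u) (at u within {0..1})"
  shows "continuous_on {0..1} (\<lambda>u. if u = 0 then f' 0 else (f u - f 0) / of_real u)"
    (is "continuous_on _ ?r")
  unfolding continuous_on_def
proof
  fix u :: real assume u: "u \<in> {0..1}"
  have cf: "continuous_on {0..1} f"
    by (intro continuous_on_eq_continuous_within[THEN iffD2] ballI has_vector_derivative_continuous[OF f])
  show "(?r \<longlongrightarrow> ?r u) (at u within {0..1})"
  proof (cases "u = 0")
    case True
    have "((\<lambda>y. (1 / norm (y - 0)) *\<^sub>R (f y - (f 0 + (y - 0) *\<^sub>R f' 0))) \<longlongrightarrow> 0) (at 0 within {0..1})"
      using f[of 0] unfolding has_vector_derivative_def has_derivative_within by simp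
    then have "((\<lambda>y. (1 / norm (y - 0)) *\<^sub>R (f y - (f 0 + (y - 0) *\<^sub>R f' 0)) + f' 0) \<longlongrightarrow> 0 + f' 0) (at 0 within {0..1})"
      by (intro tendsto_intros)
    moreover have "\<forall>\<^sub>F y in at 0 within {0..1}. (1 / norm (y - 0)) *\<^sub>R (f y - (f 0 + (y - 0) *\<^sub>R f' 0)) + f' 0 = ?r y"
      by (auto simp: eventually_at_filter scaleR_conv_of_real field_simps intro!: always_eventually)
    ultimately have "(?r \<longlongrightarrow> 0 + f' 0) (at 0 within {0..1})"
      by (rule Lim_transform_eventually)
    then show ?thesis by (simp add: True)
  next
    case False
    have "((\<lambda>y. (f y - f 0) / of_real y) \<longlongrightarrow> (f u - f 0) / of_real u) (at u within {0..1})"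
      using cf u False by (intro tendsto_intros) (auto simp: continuous_on_def)
    moreover have "\<forall>\<^sub>F y in at u within {0..1}. (f y - f 0) / of_real y = ?r y"
      unfolding eventually_at_filter using t1_space_nhds[OF False] by eventually_elim simp
    ultimately have "(?r \<longlongrightarrow> (f u - f 0) / of_real u) (at u within {0..1})"
      by (rule Lim_transform_eventually)
    then show ?thesis by (simp only: False if_False)
  qed
qed

text \<open>Only the value of the amplitude \<open>f\<close> at the singular endpoint matters: integrating by parts, the remainder
  \<open>f - f 0\<close> contributes \<open>O(1 / x)\<close>.\<close>

lemma tendsto_oscillatory_endpoint:
  assumes s: "0 < Re s" "Re s < 1"
    and f: "\<And>u. u \<in> {0..1} \<Longrightarrow> (f has_vector_derivative f' u) (at u within {0..1})"
    and cf': "continuous_on {0..1} f'"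
  shows "((\<lambda>x. of_real x powr s *
      integral {0..1} (\<lambda>u. of_real u powr (s - 1) * (f u * exp (- (\<i> * of_real (x * u))))))
    \<longlongrightarrow> f 0 * (Gamma s * exp (- (\<i> * of_real pi / 2 * s)))) at_top"
proof -
  \<comment> \<open>From f u - f 0 = u * r u, the remainder of the integrand is u powr s * r u, that
    is \<open>q\<close>. It vanishes at 0 and its derivative \<open>q'\<close> has only the
    integrable singularity u powr (s - 1), which permits one integration by parts.\<close>
  define r where "r u = (if u = 0 then f' 0 else (f u - f 0) / of_real u)" for u
  define q where "q u = of_real u powr s * r u" for u
  define q' where "q' u = of_real u powr (s - 1) * ((s - 1) * r u + f' u)" for u
  let ?e = "\<lambda>x u. exp (- (\<i> * complex_of_real (x * u)))"
  have cr: "continuous_on {0..1} r"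
    unfolding r_def using f by (rule continuous_on_difference_quotient)
  have cq: "continuous_on {0..1} q"
    unfolding q_def using s by (intro continuous_intros continuous_on_powr_complex cr) auto
  have dq: "(q has_vector_derivative q' u) (at u)" if u: "u \<in> {0<..<1}" for u
  proof -
    have "(f has_vector_derivative f' u) (at u)"
      using f[of u] u by (simp add: at_within_Icc_at)
    moreover have "((\<lambda>u. complex_of_real u powr (s - 1)) has_vector_derivative (s - 1) * of_real u powr (s - 1 - 1)) (at u)"
      using u by (intro has_vector_derivative_real_field has_field_derivative_powr) (auto simp: complex_nonpos_Reals_iff)
    ultimately have "((\<lambda>u. complex_of_real u powr (s - 1) * (f u - f 0)) has_vector_derivative
       of_real u powr (s - 1) * f' u + (s - 1) * of_real u powr (s - 1 - 1) * (f u - f 0)) (at u)"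
      by (auto intro!: derivative_eq_intros)
    moreover have "of_real u powr (s - 1) * f' u + (s - 1) * of_real u powr (s - 1 - 1) * (f u - f 0) = q' u"
    proof -
      have "complex_of_real u powr (s - 1) = of_real u powr (s - 2) * of_real u"
        using u powr_add[of "complex_of_real u" "s - 2" 1] by simp
      then show ?thesis using u by (simp add: q'_def r_def field_simps)
    qed
    moreover have "(q has_vector_derivative D) (at u) \<longleftrightarrow> ((\<lambda>u. complex_of_real u powr (s - 1) * (f u - f 0)) has_vector_derivative D) (at u)" for D
    proof (rule has_vector_derivative_cong_ev)
      have "\<forall>\<^sub>F x in nhds u. x \<in> {0<..}" using u by (intro eventually_nhds_in_open) auto
      then show "\<forall>\<^sub>F x in nhds u. x \<in> UNIV \<longrightarrow> q x = complex_of_real x powr (s - 1) * (f x - f 0)"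
        by eventually_elim (auto simp: q_def r_def powr_diff)
    qed (use u in \<open>auto simp: q_def r_def powr_diff\<close>)
    ultimately show ?thesis by metis
  qed
  have iq': "q' absolutely_integrable_on {0..1}"
    unfolding q'_def using s by (intro integrable_powr_from_0_complex continuous_intros cr cf') auto
  define C where "C = integral {0..1} (\<lambda>u. cmod (q' u)) + cmod (q 1)"
  have bound: "cmod (integral {0..1} (\<lambda>u. q u * ?e x u)) \<le> C / x" if x: "x > 0" for x
  proof -
    have iq'e: "(\<lambda>u. q' u * ?e x u) integrable_on {0..1}"
    proof -
      have "(\<lambda>u. of_real u powr (s - 1) * (((s - 1) * r u + f' u) * ?e x u)) absolutely_integrable_on {0..1}"
        using s by (intro integrable_powr_from_0_complex continuous_intros cr cf') auto
      then show ?thesis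
        unfolding q'_def by (simp add: set_lebesgue_integral_eq_integral(1) mult.assoc)
    qed
    have iqe: "(\<lambda>u. q u * ?e x u) integrable_on {0..1}"
      by (intro integrable_continuous_real continuous_intros cq)
    have "((\<lambda>u. q' u * ?e x u - \<i> * of_real x * (q u * ?e x u)) has_integral q 1 * ?e x 1 - q 0 * ?e x 0) {0..1}"
    proof (rule fundamental_theorem_of_calculus_interior)
      show "continuous_on {0..1} (\<lambda>u. q u * ?e x u)" by (intro continuous_intros cq)
      fix u :: real assume u: "u \<in> {0<..<1}"
      have "((\<lambda>u. exp (- (\<i> * (of_real x * complex_of_real u)))) has_vector_derivative - (\<i> * of_real x) * exp (- (\<i> * (of_real x * complex_of_real u)))) (at u)"
        by (rule has_vector_derivative_real_field) (auto intro!: derivative_eq_intros)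
      from has_vector_derivative_mult[OF dq[OF u] this]
      show "((\<lambda>u. q u * ?e x u) has_vector_derivative q' u * ?e x u - \<i> * of_real x * (q u * ?e x u)) (at u)"
        by (simp add: algebra_simps)
    qed auto
    moreover have "q 0 = 0" by (simp add: q_def)
    ultimately have "integral {0..1} (\<lambda>u. q' u * ?e x u - \<i> * of_real x * (q u * ?e x u)) = q 1 * ?e x 1"
      by (simp add: integral_unique)
    then have eq: "\<i> * of_real x * integral {0..1} (\<lambda>u. q u * ?e x u) = integral {0..1} (\<lambda>u. q' u * ?e x u) - q 1 * ?e x 1"
      using iqe iq'e by (simp add: integral_diff integrable_on_mult_right algebra_simps)
    have "cmod (integral {0..1} (\<lambda>u. q' u * ?e x u)) \<le> integral {0..1} (\<lambda>u. cmod (q' u))"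
      using iq' by (intro integral_norm_bound_integral iq'e)
        (auto simp: absolutely_integrable_on_def norm_mult)
    then have "cmod (\<i> * of_real x * integral {0..1} (\<lambda>u. q u * ?e x u)) \<le> C"
      unfolding eq C_def
      by (intro order_trans[OF norm_triangle_ineq4]) (simp add: norm_mult)
    then show ?thesis using x by (simp add: norm_mult field_simps)
  qed
  \<comment> \<open>The remainder integral is O(1 / x), so the normalization x powr s leaves O(x
    powr (Re s - 1)), which vanishes because Re s < 1.\<close>
  have "((\<lambda>x. of_real x powr s * integral {0..1} (\<lambda>u. q u * ?e x u)) \<longlongrightarrow> 0) at_top"
  proof (rule Lim_null_comparison)
    show "\<forall>\<^sub>F x in at_top. cmod (of_real x powr s * integral {0..1} (\<lambda>u. q u * ?e x u)) \<le> C * x powr (Re s - 1)"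
      using eventually_gt_at_top[of 0]
    proof eventually_elim
      case (elim x)
      have "cmod (of_real x powr s * integral {0..1} (\<lambda>u. q u * ?e x u)) \<le> x powr Re s * (C / x)"
        using bound[OF elim] elim by (simp only: norm_mult norm_powr_pos) (intro mult_left_mono, auto)
      then show ?case using elim by (simp add: powr_diff field_simps)
    qed
    have "((\<lambda>x. x powr (Re s - 1)) \<longlongrightarrow> 0) at_top"
      using s by (intro tendsto_neg_powr filterlim_ident) auto
    then show "((\<lambda>x. C * x powr (Re s - 1)) \<longlongrightarrow> 0) at_top"
      using tendsto_mult[OF tendsto_const[of C]] by fastforce
  qed
  moreover have "((\<lambda>x. f 0 * integral {0..x} (\<lambda>t. of_real t powr (s - 1) * exp (- (\<i> * of_real t))))
      \<longlongrightarrow> f 0 * (Gamma s * exp (- (\<i> * of_real pi / 2 * s)))) at_top"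
    by (intro tendsto_intros tendsto_oscillatory_gamma s)
  ultimately have lim: "((\<lambda>x. f 0 * integral {0..x} (\<lambda>t. of_real t powr (s - 1) * exp (- (\<i> * of_real t))) +
       of_real x powr s * integral {0..1} (\<lambda>u. q u * ?e x u))
      \<longlongrightarrow> f 0 * (Gamma s * exp (- (\<i> * of_real pi / 2 * s)))) at_top"
    using tendsto_add by fastforce
  show ?thesis
  proof (rule Lim_transform_eventually[OF lim])
    show "\<forall>\<^sub>F x in at_top. f 0 * integral {0..x} (\<lambda>t. of_real t powr (s - 1) * exp (- (\<i> * of_real t))) +
         of_real x powr s * integral {0..1} (\<lambda>u. q u * ?e x u) =
      of_real x powr s * integral {0..1} (\<lambda>u. of_real u powr (s - 1) * (f u * ?e x u))"
      using eventually_gt_at_top[of 0]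
    proof eventually_elim
      case (elim x)
      let ?b = "\<lambda>t. complex_of_real t powr (s - 1) * exp (- (\<i> * of_real t))"
      have i1: "(\<lambda>u. of_real u powr (s - 1) * ?e x u) integrable_on {0..1}"
        using s by (intro set_lebesgue_integral_eq_integral(1) integrable_powr_from_0_complex continuous_intros) auto
      \<comment> \<open>The part with the constant amplitude f 0 becomes the oscillatory Gamma
        integral up to x under the scaling t = x * u.\<close>
      have "?b integrable_on {0..x}"
        using s by (intro set_lebesgue_integral_eq_integral(1) integrable_powr_from_0_complex continuous_intros) auto
      then have "((\<lambda>u. ?b (x * u)) has_integral (1 / \<bar>x\<bar>) *\<^sub>R integral {0..x} ?b) ((\<lambda>u. u / x) ` {0..x})"
        using elim by (intro has_integral_stretch_real integrable_integral) auto
      moreover have "(\<lambda>u. u / x) ` {0..x} = {0..1}"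
        using elim image_divide_atLeastAtMost[of x 0 x] by simp
      moreover have "?b (x * u) = of_real x powr (s - 1) * (of_real u powr (s - 1) * ?e x u)" if "u \<in> {0..1}" for u
        using that elim by (simp add: powr_times_real)
      ultimately have "((\<lambda>u. of_real x powr (s - 1) * (of_real u powr (s - 1) * ?e x u)) has_integral (1 / \<bar>x\<bar>) *\<^sub>R integral {0..x} ?b) {0..1}"
        by (metis (no_types, lifting) has_integral_cong)
      then have "of_real x powr (s - 1) * integral {0..1} (\<lambda>u. of_real u powr (s - 1) * ?e x u) = integral {0..x} ?b / of_real x"
        using elim by (subst (asm) has_integral_iff) (simp add: scaleR_conv_of_real divide_inverse)
      then have 1: "of_real x powr s * integral {0..1} (\<lambda>u. of_real u powr (s - 1) * ?e x u) = integral {0..x} ?b"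
        using elim powr_diff[of "complex_of_real x" s 1] by (simp add: field_simps)
      have qe: "of_real u powr (s - 1) * (f u * ?e x u) = f 0 * (of_real u powr (s - 1) * ?e x u) + q u * ?e x u" if "u \<in> {0..1}" for u
      proof (cases "u = 0")
        case False
        then show ?thesis using that by (simp add: q_def r_def powr_diff field_simps)
      qed (simp add: q_def)
      have "integral {0..1} (\<lambda>u. of_real u powr (s - 1) * (f u * ?e x u)) =
         integral {0..1} (\<lambda>u. f 0 * (of_real u powr (s - 1) * ?e x u) + q u * ?e x u)"
        using qe by (intro Henstock_Kurzweil_Integration.integral_cong) auto
      also have "\<dots> = f 0 * integral {0..1} (\<lambda>u. of_real u powr (s - 1) * ?e x u) + integral {0..1} (\<lambda>u. q u * ?e x u)"
        by (subst Henstock_Kurzweil_Integration.integral_add[OF integrable_on_mult_right[OF i1]])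
          (simp_all add: integrable_continuous_real continuous_intros cq)
      finally show ?case using 1 by (simp add: algebra_simps)
    qed
  qed
qed

lemma integral_reflect_01:
  fixes g :: "real \<Rightarrow> 'a::euclidean_space"
  shows "integral {0..1} (\<lambda>v. g (1 - v)) = integral {0..1} g"
  using Henstock_Kurzweil_Integration.integral_reflect_real[of 0 "-1" "\<lambda>x. g (1 + x)"] integral_shift_Icc_real[of "-1" 0 g 1]
  by (simp add: o_def)

text \<open>The reflection v = 1 - u moves the singular endpoint to 0 and splits off exp (i * x).
  The amplitude (1 - u) ^ n * (2 - u) powr (q - 1) equals 2 powr (q - 1) at u = 0 whatever n is, so
  all moments share one leading coefficient.\<close>

lemma tendsto_jacobi_exp:
  assumes p: "0 < Re p" "Re p < 1"
  shows "((\<lambda>x. of_real x powr p * (exp (- (\<i> * of_real x)) * jacobi_exp p q n (\<i> * of_real x)))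
    \<longlongrightarrow> 2 powr (q - 1) * (Gamma p * exp (- (\<i> * of_real pi / 2 * p)))) at_top"
proof -
  define f where "f u = of_real (1 - u) ^ n * of_real (2 - u) powr (q - 1)" for u :: real
  define f' where "f' u = - of_nat n * of_real (1 - u) ^ (n - 1) * of_real (2 - u) powr (q - 1)
     - (q - 1) * of_real (1 - u) ^ n * of_real (2 - u) powr (q - 2)" for u :: real
  have "(f has_vector_derivative f' u) (at u within {0..1})" if "u \<in> {0..1}" for u
  proof -
    have "2 - complex_of_real u \<notin> \<real>\<^sub>\<le>\<^sub>0" using that by (auto simp: complex_nonpos_Reals_iff)
    then have "((\<lambda>w. (1 - w) ^ n * (2 - w) powr (q - 1)) has_field_derivative f' u) (at (of_real u))"
      by (auto intro!: derivative_eq_intros simp: f'_def algebra_simps)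
    then have "((\<lambda>u. (1 - of_real u) ^ n * (2 - of_real u) powr (q - 1)) has_vector_derivative f' u) (at u within {0..1})"
      by (rule has_vector_derivative_real_field)
    then show ?thesis by (simp add: f_def[abs_def])
  qed
  moreover have "continuous_on {0..1} f'"
    unfolding f'_def by (intro continuous_intros continuous_on_of_real_powr) auto
  ultimately have lim: "((\<lambda>x. of_real x powr p *
      integral {0..1} (\<lambda>u. of_real u powr (p - 1) * (f u * exp (- (\<i> * of_real (x * u))))))
    \<longlongrightarrow> f 0 * (Gamma p * exp (- (\<i> * of_real pi / 2 * p)))) at_top"
    by (intro tendsto_oscillatory_endpoint p) auto
  have "exp (- (\<i> * of_real x)) * jacobi_exp p q n (\<i> * of_real x) =
     integral {0..1} (\<lambda>u. of_real u powr (p - 1) * (f u * exp (- (\<i> * of_real (x * u)))))" for x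
  proof -
    have "exp (- (\<i> * of_real x)) * jacobi_exp p q n (\<i> * of_real x) =
       integral {0..1} (\<lambda>v. exp (- (\<i> * of_real x)) * (of_real v ^ n * exp (\<i> * of_real x * of_real v) * jacobi_weight p q v))"
      unfolding jacobi_exp_def by simp
    also have "\<dots> = integral {0..1} (\<lambda>v. of_real (1 - v) powr (p - 1) * (f (1 - v) * exp (- (\<i> * of_real (x * (1 - v))))))"
      by (intro Henstock_Kurzweil_Integration.integral_cong)
        (simp add: jacobi_weight_def f_def exp_diff exp_minus field_simps)
    also have "\<dots> = integral {0..1} (\<lambda>u. of_real u powr (p - 1) * (f u * exp (- (\<i> * of_real (x * u)))))"
      by (rule integral_reflect_01)
    finally show ?thesis .
  qed
  with lim show ?thesis by (simp add: f_def)
qed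

section \<open>Integral representation of the even and odd solutions\<close>

text \<open>For n = 0 this is h; the exponents with real part 1/4 and 3/4 serve the even and the odd
  solution. Conjugate exponents and an imaginary argument make the reflection v -> -v act as
  conjugation of the integrand.\<close>

definition weber_osc :: "complex \<Rightarrow> nat \<Rightarrow> real \<Rightarrow> complex" where
  "weber_osc s n x = jacobi_exp s (cnj s) n (\<i> * of_real (x\<^sup>2 / 4))"

lemma weber_osc_zero: "weber_osc s n 0 = jacobi_exp s (cnj s) n 0"
  by (simp add: weber_osc_def)

lemma has_vector_derivative_weber_osc:
  assumes "Re s > 0"
  shows "(weber_osc s n has_vector_derivative \<i> * of_real (x / 2) * weber_osc s (Suc n) x) (at x within A)"
proof -
  have "((\<lambda>w. jacobi_exp s (cnj s) n (\<i> * (w\<^sup>2 / 4))) has_field_derivative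
      jacobi_exp s (cnj s) (Suc n) (\<i> * ((of_real x)\<^sup>2 / 4)) * (\<i> * (2 * of_real x / 4))) (at (of_real x))"
    by (rule DERIV_chain2[OF has_field_derivative_jacobi_exp[OF assms]])
      (auto intro!: derivative_eq_intros)
  from has_vector_derivative_real_field[OF this, of A] show ?thesis
    by (simp add: weber_osc_def[abs_def] mult_ac)
qed

text \<open>Here \<open>r n\<close> is the rising factorial of 2 * c. Rescaled by it and by i ^ n,
  the moments at z = 0 satisfy the real recurrence of the Weber coefficients, except that the first
  step has an extra term i. Being imaginary, this term never reaches the real parts. The cases c =
  1/4 and c = 3/4 are \<open>weber_alpha\<close> and \<open>weber_beta\<close>.\<close>

lemma weber_osc_moment:
  fixes a c :: real and r w :: "nat \<Rightarrow> real"
  assumes c: "c > 0" and r: "r 0 = 1" "\<And>n. r (Suc n) = (real n + 2 * c) * r n"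
    and w: "w 0 = 1" "w (Suc 0) = a"
      "\<And>n. w (Suc (Suc n)) = a * w (Suc n) - (real n + 1) * (real n + 2 * c) * w n"
  defines "s \<equiv> Complex c (a / 2)"
  shows "Re (\<i> ^ n * of_real (r n) * jacobi_exp s (cnj s) n 0) = w n * Re (jacobi_exp s (cnj s) 0 0)"
proof -
  let ?T = "\<lambda>n. jacobi_exp s (cnj s) n 0"
  define t where "t n = \<i> ^ n * of_real (r n) * ?T n" for n
  have s: "Re s > 0" using c by (simp add: s_def)
  have d: "s - cnj s = \<i> * of_real a" "s + cnj s = of_real (2 * c)"
    by (simp_all add: s_def complex_eq_iff)
  have "of_real (2 * c) * ?T (Suc 0) = 1 - \<i> * of_real a * ?T 0"
    using jacobi_exp_recurrence[OF s, of 0 "cnj s" 0] unfolding d by (simp add: algebra_simps)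
  moreover have "t (Suc 0) = \<i> * (of_real (2 * c) * ?T (Suc 0))"
    by (simp add: t_def r)
  ultimately have "t (Suc 0) = \<i> * (1 - \<i> * of_real a * ?T 0)"
    by (simp only:)
  then have t1: "t (Suc 0) = of_real a * t 0 + \<i>"
    by (simp add: t_def r algebra_simps)
  have tSS: "t (Suc (Suc n)) = of_real a * t (Suc n) - of_real ((real n + 1) * (real n + 2 * c)) * t n" for n
  proof -
    have rec: "of_real (real (Suc n) + 2 * c) * ?T (Suc (Suc n)) = of_nat (Suc n) * ?T n - \<i> * of_real a * ?T (Suc n)"
      using jacobi_exp_recurrence[OF s, of "Suc n" "cnj s" 0] unfolding d by (simp add: algebra_simps)
    have "t (Suc (Suc n)) = \<i> ^ (Suc (Suc n)) * of_real (r (Suc n)) * (of_real (real (Suc n) + 2 * c) * ?T (Suc (Suc n)))"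
      unfolding t_def r(2)[of "Suc n"] by simp
    also have "\<dots> = of_real a * t (Suc n) - of_real ((real n + 1) * (real n + 2 * c)) * t n"
      unfolding rec unfolding t_def r(2)[of n] by (simp add: algebra_simps)
    finally show ?thesis .
  qed
  have "Re (t n) = w n * Re (?T 0) \<and> Re (t (Suc n)) = w (Suc n) * Re (?T 0)"
  proof (induction n)
    case 0
    then show ?case using t1 by (simp add: t_def r w)
  next
    case (Suc n)
    then show ?case unfolding tSS[of n] w(3) by (simp add: algebra_simps)
  qed
  then show ?thesis by (simp add: t_def)
qed

lemma weber_osc_sums:
  fixes a c :: real and r w :: "nat \<Rightarrow> real"
  assumes c: "c > 0" and r: "r 0 = 1" "\<And>n. r (Suc n) = (real n + 2 * c) * r n"
    and w: "w 0 = 1" "w (Suc 0) = a"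
      "\<And>n. w (Suc (Suc n)) = a * w (Suc n) - (real n + 1) * (real n + 2 * c) * w n"
  defines "s \<equiv> Complex c (a / 2)"
  assumes nz: "Re (weber_osc s 0 0) \<noteq> 0"
  shows "(\<lambda>n. w n * x ^ (2 * n) / (4 ^ n * fact n * r n)) sums (Re (weber_osc s 0 x) / Re (weber_osc s 0 0))"
proof -
  have s: "Re s > 0" using c by (simp add: s_def)
  have rpos: "r n > 0" for n
    using c by (induction n) (simp_all add: r)
  let ?T = "\<lambda>n. jacobi_exp s (cnj s) n 0"
  have "(\<lambda>n. Re (?T n / fact n * (\<i> * of_real (x\<^sup>2 / 4)) ^ n)) sums Re (weber_osc s 0 x)"
    using sums_Re[OF jacobi_exp_sums[OF s, of "cnj s" 0 "\<i> * of_real (x\<^sup>2 / 4)"]] by (simp add: weber_osc_def)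
  moreover have "Re (?T n / fact n * (\<i> * of_real (x\<^sup>2 / 4)) ^ n) =
      w n * x ^ (2 * n) / (4 ^ n * fact n * r n) * Re (weber_osc s 0 0)" for n
  proof -
    have "?T n / fact n * (\<i> * of_real (x\<^sup>2 / 4)) ^ n =
      of_real (x ^ (2 * n) / (4 ^ n * fact n * r n)) * (\<i> ^ n * of_real (r n) * ?T n)"
      using rpos[of n] by (simp add: power_mult_distrib power_divide field_simps flip: power_mult)
    then have "Re (?T n / fact n * (\<i> * of_real (x\<^sup>2 / 4)) ^ n) =
      x ^ (2 * n) / (4 ^ n * fact n * r n) * Re (\<i> ^ n * of_real (r n) * ?T n)"
      by (simp only: Re_complex_of_real times_complex.sel Im_complex_of_real mult_zero_left diff_0_right)
    also have "Re (\<i> ^ n * of_real (r n) * ?T n) = w n * Re (?T 0)"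
      unfolding s_def by (rule weber_osc_moment[OF c r w])
    finally show ?thesis by (simp add: weber_osc_zero)
  qed
  ultimately have "(\<lambda>n. w n * x ^ (2 * n) / (4 ^ n * fact n * r n) * Re (weber_osc s 0 0)) sums Re (weber_osc s 0 x)"
    by simp
  from sums_divide[OF this, of "Re (weber_osc s 0 0)"] nz
  show ?thesis by simp
qed

lemma weber_w1_integral:
  fixes a :: real
  defines "s \<equiv> Complex (1/4) (a / 2)"
  assumes nz: "Re (weber_osc s 0 0) \<noteq> 0"
  shows "weber_w1 a x = Re (weber_osc s 0 x) / Re (weber_osc s 0 0)"
proof -
  \<comment> \<open>The rising factorial of 1/2, written so that 4 ^ n * fact n * r n is visibly
    fact (2 * n).\<close>
  define r where "r n = fact (2 * n) / (4 ^ n * fact n :: real)" for n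
  have r: "r (Suc n) = (real n + 2 * (1/4)) * r n" for n
  proof -
    have "(fact (2 * Suc n) :: real) = 4 * real (Suc n) * (real n + 2 * (1/4)) * fact (2 * n)"
      by (simp add: algebra_simps)
    moreover have "(fact (Suc n) :: real) = real (Suc n) * fact n" by simp
    ultimately show ?thesis
      unfolding r_def by (simp only: power_Suc) (simp add: field_simps del: of_nat_Suc fact_Suc)
  qed
  have "(\<lambda>n. weber_alpha a n * x ^ (2 * n) / (4 ^ n * fact n * r n)) sums
    (Re (weber_osc s 0 x) / Re (weber_osc s 0 0))"
    using nz unfolding s_def
    by (intro weber_osc_sums[OF _ _ r]) (simp_all add: r_def add_divide_distrib algebra_simps)
  then show ?thesis by (simp add: weber_w1_def sums_iff r_def)
qed

lemma weber_w2_integral: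
  fixes a :: real
  defines "s \<equiv> Complex (3/4) (a / 2)"
  assumes nz: "Re (weber_osc s 0 0) \<noteq> 0"
  shows "weber_w2 a x = x * Re (weber_osc s 0 x) / Re (weber_osc s 0 0)"
proof -
  \<comment> \<open>The rising factorial of 3/2; here 4 ^ n * fact n * r n is fact (2 * n +
    1).\<close>
  define r where "r n = fact (2 * n + 1) / (4 ^ n * fact n :: real)" for n
  have r: "r (Suc n) = (real n + 2 * (3/4)) * r n" for n
  proof -
    have "(fact (2 * Suc n + 1) :: real) = 4 * real (Suc n) * (real n + 2 * (3/4)) * fact (2 * n + 1)"
      by (simp add: algebra_simps)
    moreover have "(fact (Suc n) :: real) = real (Suc n) * fact n" by simp
    ultimately show ?thesis
      unfolding r_def by (simp only: power_Suc) (simp add: field_simps del: of_nat_Suc fact_Suc)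
  qed
  have "(\<lambda>n. weber_beta a n * x ^ (2 * n) / (4 ^ n * fact n * r n)) sums
    (Re (weber_osc s 0 x) / Re (weber_osc s 0 0))"
    using nz unfolding s_def
    by (intro weber_osc_sums[OF _ _ r]) (simp_all add: r_def add_divide_distrib algebra_simps)
  from sums_mult[OF this, of x] show ?thesis by (simp add: weber_w2_def sums_iff r_def mult_ac)
qed

section \<open>Differential equations and Green's identity\<close>

lemma has_real_derivative_Re_Im:
  assumes "(f has_vector_derivative D) (at x within A)"
  shows has_real_derivative_Re: "((\<lambda>x. Re (f x)) has_real_derivative Re D) (at x within A)"
    and has_real_derivative_Im: "((\<lambda>x. Im (f x)) has_real_derivative Im D) (at x within A)"
  using bounded_linear.has_vector_derivative[OF bounded_linear_Re assms]
    bounded_linear.has_vector_derivative[OF bounded_linear_Im assms]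
  by (simp_all add: has_real_derivative_iff_has_vector_derivative)

text \<open>This is the moment recurrence for n = 0 multiplied by -i. For c = 1/4 the left side is
  the second derivative of \<open>weber_osc s 0\<close>; for c = 3/4, x times the left side is the
  second derivative of x * \<open>weber_osc s 0 x\<close>.\<close>

lemma weber_osc_ode:
  fixes a c x :: real
  assumes "c > 0"
  defines "s \<equiv> Complex c (a / 2)"
  shows "\<i> * of_real (2 * c) * weber_osc s (Suc 0) x - of_real (x\<^sup>2 / 4) * weber_osc s 2 x =
    of_real (a - x\<^sup>2 / 4) * weber_osc s 0 x + \<i>"
proof -
  have s: "Re s > 0" using assms by simp
  have d: "s - cnj s = \<i> * of_real a" "s + cnj s = of_real (2 * c)"
    by (simp_all add: s_def complex_eq_iff)
  have "\<i> * of_real (x\<^sup>2 / 4) * (weber_osc s 0 x - weber_osc s 2 x) - \<i> * of_real a * weber_osc s 0 x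
      - of_real (2 * c) * weber_osc s (Suc 0) x = - 1"
    using jacobi_exp_recurrence[OF s, of 0 "cnj s" "\<i> * of_real (x\<^sup>2 / 4)"] unfolding d
    by (simp add: weber_osc_def numeral_2_eq_2)
  from arg_cong[OF this, of "\<lambda>z. - \<i> * z"] show ?thesis
    by (simp add: algebra_simps diff_divide_distrib)
qed

text \<open>\<open>Im (weber_osc s 0)\<close> solves the inhomogeneous equation \<open>g'' = (a - x\<^sup>2 / 4) * g + 1\<close>,
  so by Green's identity the integral of a solution of the homogeneous equation is the increment of a Wronskian.\<close>
lemma green_integral:
  fixes y g y' g' k :: "real \<Rightarrow> real"
  assumes y: "\<And>x. (y has_real_derivative y' x) (at x)" "\<And>x. (y' has_real_derivative k x * y x) (at x)"
    and g: "\<And>x. (g has_real_derivative g' x) (at x)" "\<And>x. (g' has_real_derivative k x * g x + 1) (at x)"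
    and "R \<ge> 0"
  shows "integral {0..R} y = (y R * g' R - g R * y' R) - (y 0 * g' 0 - g 0 * y' 0)"
proof (rule integral_unique, rule fundamental_theorem_of_calculus)
  fix x
  have "((\<lambda>x. y x * g' x - g x * y' x) has_real_derivative
    (y' x * g' x + (k x * g x + 1) * y x) - (g' x * y' x + k x * y x * g x)) (at x)"
    by (intro DERIV_diff DERIV_mult y g)
  then have "((\<lambda>x. y x * g' x - g x * y' x) has_real_derivative y x) (at x)"
    by (simp add: algebra_simps)
  then show "((\<lambda>x. y x * g' x - g x * y' x) has_vector_derivative y x) (at x within {0..R})"
    by (simp add: has_real_derivative_iff_has_vector_derivative has_vector_derivative_at_within)
qed fact

context
  fixes a :: real and s :: complex
  defines "s \<equiv> Complex (1/4) (a / 2)"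
begin

lemma weber_osc_quarter_derivs:
  shows "(weber_osc s 0 has_vector_derivative \<i> * of_real (x / 2) * weber_osc s (Suc 0) x) (at x)"
    and "((\<lambda>x. \<i> * of_real (x / 2) * weber_osc s (Suc 0) x) has_vector_derivative
      of_real (a - x\<^sup>2 / 4) * weber_osc s 0 x + \<i>) (at x)"
proof -
  have s: "Re s > 0" by (simp add: s_def)
  show "(weber_osc s 0 has_vector_derivative \<i> * of_real (x / 2) * weber_osc s (Suc 0) x) (at x)"
    by (rule has_vector_derivative_weber_osc[OF s])
  have "((\<lambda>x. \<i> * of_real (x / 2)) has_vector_derivative \<i> / 2) (at x)"
    by (auto intro!: derivative_eq_intros has_vector_derivative_real_field[of "\<lambda>w. \<i> * (w / 2)", simplified])
  from has_vector_derivative_mult[OF this has_vector_derivative_weber_osc[OF s, of "Suc 0" x UNIV]]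
  have "((\<lambda>x. \<i> * of_real (x / 2) * weber_osc s (Suc 0) x) has_vector_derivative
      \<i> * of_real (x / 2) * (\<i> * of_real (x / 2) * weber_osc s (Suc (Suc 0)) x) + \<i> / 2 * weber_osc s (Suc 0) x) (at x)"
    by simp
  also have "\<i> * of_real (x / 2) * (\<i> * of_real (x / 2) * weber_osc s (Suc (Suc 0)) x) + \<i> / 2 * weber_osc s (Suc 0) x =
     of_real (a - x\<^sup>2 / 4) * weber_osc s 0 x + \<i>"
    using weber_osc_ode[of "1/4" a x] unfolding s_def[symmetric]
    by (simp add: algebra_simps power2_eq_square numeral_2_eq_2)
  finally show "((\<lambda>x. \<i> * of_real (x / 2) * weber_osc s (Suc 0) x) has_vector_derivative
      of_real (a - x\<^sup>2 / 4) * weber_osc s 0 x + \<i>) (at x)" .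
qed

text \<open>Green's identity with y and g the real and imaginary parts of the same h. Their
  Wronskian is Im (cnj h * h'), where h' is i * R / 2 times the next moment; this factor makes it
  vanish at 0.\<close>

lemma integral_Re_weber_osc:
  assumes "R \<ge> 0"
  shows "integral {0..R} (\<lambda>x. Re (weber_osc s 0 x)) = R / 2 * Re (weber_osc s 0 R * cnj (weber_osc s (Suc 0) R))"
proof -
  have "integral {0..R} (\<lambda>x. Re (weber_osc s 0 x)) =
     (Re (weber_osc s 0 R) * Im (\<i> * of_real (R / 2) * weber_osc s (Suc 0) R) -
      Im (weber_osc s 0 R) * Re (\<i> * of_real (R / 2) * weber_osc s (Suc 0) R)) -
     (Re (weber_osc s 0 0) * Im (\<i> * of_real (0 / 2) * weber_osc s (Suc 0) 0) -
      Im (weber_osc s 0 0) * Re (\<i> * of_real (0 / 2) * weber_osc s (Suc 0) 0))"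
    using has_real_derivative_Re[OF weber_osc_quarter_derivs(1)] has_real_derivative_Re[OF weber_osc_quarter_derivs(2)]
      has_real_derivative_Im[OF weber_osc_quarter_derivs(1)] has_real_derivative_Im[OF weber_osc_quarter_derivs(2)]
    by (intro green_integral[where k = "\<lambda>x. a - x\<^sup>2 / 4"] assms) simp_all
  then show ?thesis by (simp add: algebra_simps)
qed

text \<open>Now y is the odd solution, built from the exponent 3/4 + ia/2, while g remains the
  imaginary part for 1/4 + ia/2, the solution of the equation with right-hand side 1. At 0 the term
  g * y' survives; it is the origin of \<open>Y\<close>.\<close>

lemma integral_Re_weber_osc_odd:
  assumes "R \<ge> 0"
  defines "q \<equiv> Complex (3/4) (a / 2)"
  shows "integral {0..R} (\<lambda>x. x * Re (weber_osc q 0 x)) =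
    R\<^sup>2 / 2 * (Re (weber_osc q 0 R) * Re (weber_osc s (Suc 0) R) + Im (weber_osc s 0 R) * Im (weber_osc q (Suc 0) R))
    - Im (weber_osc s 0 R) * Re (weber_osc q 0 R) + Im (weber_osc s 0 0) * Re (weber_osc q 0 0)"
proof -
  have q: "Re q > 0" by (simp add: q_def)
  define y' where "y' x = Re (weber_osc q 0 x) - x\<^sup>2 / 2 * Im (weber_osc q (Suc 0) x)" for x
  have d: "((\<lambda>x. Re (weber_osc q n x)) has_real_derivative - x / 2 * Im (weber_osc q (Suc n) x)) (at x)"
    "((\<lambda>x. Im (weber_osc q n x)) has_real_derivative x / 2 * Re (weber_osc q (Suc n) x)) (at x)" for n x
    using has_real_derivative_Re_Im[OF has_vector_derivative_weber_osc[OF q, of n x UNIV]] by simp_all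
  have y: "((\<lambda>x. x * Re (weber_osc q 0 x)) has_real_derivative y' x) (at x)" for x
    using DERIV_mult[OF DERIV_ident d(1)[where n = 0]] by (simp add: y'_def power2_eq_square algebra_simps)
  have yy: "(y' has_real_derivative (a - x\<^sup>2 / 4) * (x * Re (weber_osc q 0 x))) (at x)" for x
  proof -
    have "((\<lambda>x. x\<^sup>2 / 2) has_real_derivative x) (at x)" for x :: real
      by (auto intro!: derivative_eq_intros)
    from DERIV_diff[OF d(1)[where n = 0] DERIV_mult[OF this d(2)[where n = "Suc 0"]]]
    have "(y' has_real_derivative - x / 2 * Im (weber_osc q (Suc 0) x) -
       (x * Im (weber_osc q (Suc 0) x) + x / 2 * Re (weber_osc q (Suc (Suc 0)) x) * (x\<^sup>2 / 2))) (at x)"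
      by (simp add: y'_def[abs_def])
    also have "- x / 2 * Im (weber_osc q (Suc 0) x) -
       (x * Im (weber_osc q (Suc 0) x) + x / 2 * Re (weber_osc q (Suc (Suc 0)) x) * (x\<^sup>2 / 2)) =
       x * (- (3 / 2) * Im (weber_osc q (Suc 0) x) - x\<^sup>2 / 4 * Re (weber_osc q 2 x))"
      by (simp add: algebra_simps numeral_2_eq_2)
    also have "- (3 / 2) * Im (weber_osc q (Suc 0) x) - x\<^sup>2 / 4 * Re (weber_osc q 2 x) = (a - x\<^sup>2 / 4) * Re (weber_osc q 0 x)"
      using arg_cong[OF weber_osc_ode[of "3/4" a x], of Re] unfolding q_def[symmetric] by simp
    finally show ?thesis by (simp add: mult_ac)
  qed
  have "integral {0..R} (\<lambda>x. x * Re (weber_osc q 0 x)) =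
     (R * Re (weber_osc q 0 R) * Im (\<i> * of_real (R / 2) * weber_osc s (Suc 0) R) - Im (weber_osc s 0 R) * y' R) -
     (0 * Re (weber_osc q 0 0) * Im (\<i> * of_real (0 / 2) * weber_osc s (Suc 0) 0) - Im (weber_osc s 0 0) * y' 0)"
    using has_real_derivative_Im[OF weber_osc_quarter_derivs(1)] has_real_derivative_Im[OF weber_osc_quarter_derivs(2)]
    by (intro green_integral[where k = "\<lambda>x. a - x\<^sup>2 / 4"] assms y yy) simp_all
  then show ?thesis by (simp add: y'_def algebra_simps power2_eq_square)
qed

end

section \<open>Values at the origin\<close>

lemma cnj_jacobi_weight:
  assumes "v \<in> {-1..1}"
  shows "cnj (jacobi_weight p q v) = jacobi_weight (cnj q) (cnj p) (- v)"
proof -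
  have "cnj (complex_of_real x powr z) = complex_of_real x powr cnj z" if "x \<ge> 0" for x z
    using that by (cases "x = 0") (simp_all add: cnj_powr)
  from this[of "1 - v" "p - 1"] this[of "1 + v" "q - 1"] assms show ?thesis
    by (simp add: jacobi_weight_def mult.commute)
qed

lemma has_integral_jacobi_weight:
  assumes "Re p > 0"
  shows "(jacobi_weight p q has_integral jacobi_exp p q 0 0) {0..1}"
  using integrable_integral[OF integrable_jacobi_exp[OF assms, of 0 0 q]]
  by (simp add: jacobi_exp_def)

text \<open>Conjugating the weight reflects v, so T + cnj T is the integral over -1..1. The
  substitution x = (1 + v) / 2 identifies it with Beta (cnj s) s, that is, the squared modulus of
  Gamma s over Gamma (2 * c).\<close>

lemma Re_weber_osc_zero:
  assumes c: "c > 0"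
  shows "Re (weber_osc (Complex c b) 0 0) = 2 powr (2 * c - 2) * (cmod (Gamma (Complex c b)))\<^sup>2 / Gamma (2 * c)"
proof -
  define s where "s = Complex c b"
  define T where "T = jacobi_exp s (cnj s) 0 0"
  have s: "Re s > 0" "Re (cnj s) > 0" using c by (simp_all add: s_def)
  define B where "B = Beta (cnj s) s"
  have "((\<lambda>v. beta_kernel (cnj s) s ((1/2) *\<^sub>R v + 1/2)) has_integral B /\<^sub>R (1/2) ^ DIM(real)) (cbox ((0 - 1/2) /\<^sub>R (1/2)) ((1 - 1/2) /\<^sub>R (1/2)))"
    unfolding B_def
    by (rule has_integral_affinity') (use has_integral_Beta_complex[OF s(2,1)] in auto)
  then have "((\<lambda>v. beta_kernel (cnj s) s (v / 2 + 1/2)) has_integral 2 * B) {-1..1}"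
    by (simp add: scaleR_conv_of_real)
  moreover have "beta_kernel (cnj s) s (v / 2 + 1/2) = of_real (2 powr (2 - 2 * c)) * jacobi_weight s (cnj s) v"
    if v: "v \<in> {-1..1}" for v
  proof -
    have h: "complex_of_real (x / 2) powr z = of_real x powr z * (1 / 2) powr z" if "x \<ge> 0" for x z
      using powr_times_real[of "complex_of_real x" "1/2" z] that by simp
    \<comment> \<open>The two powers of 1/2 have conjugate exponents, so their product is
      real.\<close>
    have k: "(1 / 2 :: complex) powr (cnj s - 1) * (1 / 2) powr (s - 1) = of_real (2 powr (2 - 2 * c))"
    proof -
      have "(1 / 2 :: complex) powr (cnj s - 1) * (1 / 2) powr (s - 1) = (1 / 2) powr ((cnj s - 1) + (s - 1))"
        by (subst powr_add) simp
      also have "(cnj s - 1) + (s - 1) = of_real (2 * c - 2)"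
        by (simp add: s_def complex_eq_iff)
      also have "(1 / 2 :: complex) powr of_real (2 * c - 2) = of_real ((1/2) powr (2 * c - 2))"
        using powr_of_real[of "1/2" "2 * c - 2"] by simp
      also have "(1 / 2 :: real) powr (2 * c - 2) = 2 powr (2 - 2 * c)"
      proof -
        have "(1 / 2 :: real) = 2 powr - 1" by (simp add: powr_minus_divide)
        then show ?thesis by (simp only: powr_powr) simp
      qed
      finally show ?thesis .
    qed
    have v': "1 + v \<ge> 0" "1 - v \<ge> 0" using v by auto
    have e: "v / 2 + 1 / 2 = (1 + v) / 2" "1 - (1 + v) / 2 = (1 - v) / 2" by (simp_all add: field_simps)
    have "beta_kernel (cnj s) s (v / 2 + 1/2) =
        (of_real (1 + v) powr (cnj s - 1) * (1/2) powr (cnj s - 1)) * (of_real (1 - v) powr (s - 1) * (1/2) powr (s - 1))"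
      unfolding beta_kernel_def e using v by (simp only: h[OF v'(1)] h[OF v'(2)])
    also have "\<dots> = ((1 / 2 :: complex) powr (cnj s - 1) * (1 / 2) powr (s - 1)) * jacobi_weight s (cnj s) v"
      by (simp add: jacobi_weight_def mult_ac)
    finally show ?thesis unfolding k .
  qed
  ultimately have 1: "((\<lambda>v. of_real (2 powr (2 - 2 * c)) * jacobi_weight s (cnj s) v) has_integral 2 * B) {-1..1}"
    by (rule has_integral_eq[rotated]) auto
  have r: "(jacobi_weight s (cnj s) has_integral T) {0..1}"
    unfolding T_def by (rule has_integral_jacobi_weight[OF s(1)])
  have "((\<lambda>v. cnj (jacobi_weight s (cnj s) v)) has_integral cnj T) {0..1}"
    using has_integral_cnj[of "jacobi_weight s (cnj s)" T "{0..1}"] r by (simp add: o_def)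
  then have "((\<lambda>v. jacobi_weight s (cnj s) (- v)) has_integral cnj T) {0..1}"
    by (rule has_integral_eq[rotated]) (simp add: cnj_jacobi_weight)
  then have l: "(jacobi_weight s (cnj s) has_integral cnj T) {-1..0}"
    using has_integral_reflect_real[where f = "jacobi_weight s (cnj s)" and i = "cnj T" and a = "-1" and b = 0] by simp
  have "((\<lambda>v. of_real (2 powr (2 - 2 * c)) * jacobi_weight s (cnj s) v) has_integral of_real (2 powr (2 - 2 * c)) * (cnj T + T)) {-1..1}"
    by (intro has_integral_mult_right has_integral_combine[OF _ _ l r]) auto
  from has_integral_unique[OF this 1] have "of_real (2 powr (2 - 2 * c)) * (cnj T + T) = 2 * B" .
  moreover have "cnj T + T = of_real (2 * Re T)" by (simp add: complex_eq_iff)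
  moreover have "B = of_real ((cmod (Gamma s))\<^sup>2 / Gamma (2 * c))"
  proof -
    have "cnj s + s = of_real (2 * c)" by (simp add: s_def complex_eq_iff)
    then have "B = Gamma (cnj s) * Gamma s / of_real (Gamma (2 * c))"
      unfolding B_def Beta_def by (simp only: Gamma_complex_of_real)
    also have "Gamma (cnj s) * Gamma s = of_real ((cmod (Gamma s))\<^sup>2)"
      using complex_norm_square[of "Gamma s"] by (simp add: cnj_Gamma[symmetric] mult.commute)
    finally show ?thesis by simp
  qed
  ultimately have "complex_of_real (2 powr (2 - 2 * c) * (2 * Re T)) = complex_of_real (2 * ((cmod (Gamma s))\<^sup>2 / Gamma (2 * c)))"
    by simp
  then have "2 powr (2 - 2 * c) * Re T = (cmod (Gamma s))\<^sup>2 / Gamma (2 * c)"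
    by (simp only: of_real_eq_iff)
  then show ?thesis
    by (simp add: weber_osc_zero T_def s_def powr_diff field_simps)
qed

section \<open>The incomplete Beta integral as a hypergeometric series\<close>

text \<open>Up to a power of 2 this is the incomplete Beta function B_{1/2}(p + n, q), as the
  substitution u = 2 * t shows.\<close>

definition half_beta :: "complex \<Rightarrow> complex \<Rightarrow> nat \<Rightarrow> complex" where
  "half_beta p q n = integral {0..1} (\<lambda>u. of_real u powr (p + of_nat n - 1) * of_real (2 - u) powr (q - 1))"

context
  fixes p q :: complex
  assumes p: "Re p > 0"
begin

lemma integrable_half_beta:
  "(\<lambda>u. of_real u powr (p + of_nat n - 1) * of_real (2 - u) powr (q - 1)) integrable_on {0..1}"
  using p by (intro set_lebesgue_integral_eq_integral(1) integrable_powr_from_0_complex continuous_on_of_real_powr continuous_intros) auto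

text \<open>Integrates the derivative of \<open>u powr (p + n) * (2 - u) powr q\<close>. Iterating it produces the series of the
  hypergeometric function at \<open>1/2\<close>.\<close>

lemma half_beta_rec: "2 * (p + of_nat n) * half_beta p q n - (p + q + of_nat n) * half_beta p q (Suc n) = 1"
proof -
  let ?P = "p + of_nat n"
  let ?k = "\<lambda>n u. complex_of_real u powr (p + of_nat n - 1) * of_real (2 - u) powr (q - 1)"
  have P: "Re ?P > 0" using p by simp
  have 1: "((\<lambda>u. 2 * ?P * ?k n u - (p + q + of_nat n) * ?k (Suc n) u) has_integral
     of_real 1 powr ?P * of_real (2 - 1) powr q - of_real 0 powr ?P * of_real (2 - 0) powr q) {0..1}"
  proof (rule fundamental_theorem_of_calculus_interior)
    show "continuous_on {0..1} (\<lambda>u. complex_of_real u powr ?P * of_real (2 - u) powr q)"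
      using P by (intro continuous_intros continuous_on_of_real_powr continuous_on_powr_complex) auto
    fix u :: real assume u: "u \<in> {0<..<1}"
    have np: "complex_of_real u \<notin> \<real>\<^sub>\<le>\<^sub>0" "2 - complex_of_real u \<notin> \<real>\<^sub>\<le>\<^sub>0"
      using u by (auto simp: complex_nonpos_Reals_iff)
    have "((\<lambda>w. w powr ?P * (2 - w) powr q) has_field_derivative
       ?P * of_real u powr (?P - 1) * (2 - of_real u) powr q - q * of_real u powr ?P * (2 - of_real u) powr (q - 1)) (at (of_real u))"
      using np by (auto intro!: derivative_eq_intros)
    then have "((\<lambda>u. complex_of_real u powr ?P * (2 - of_real u) powr q) has_vector_derivative
       ?P * of_real u powr (?P - 1) * (2 - of_real u) powr q - q * of_real u powr ?P * (2 - of_real u) powr (q - 1)) (at u)"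
      by (rule has_vector_derivative_real_field)
    moreover have "complex_of_real u powr ?P = of_real u powr (?P - 1) * of_real u"
      "(2 - complex_of_real u) powr q = (2 - of_real u) powr (q - 1) * (2 - of_real u)"
      using np u powr_add[of "complex_of_real u" "?P - 1" 1] powr_add[of "2 - complex_of_real u" "q - 1" 1] by auto
    moreover have "p + of_nat (Suc n) - 1 = ?P" by simp
    ultimately show "((\<lambda>u. complex_of_real u powr ?P * of_real (2 - u) powr q) has_vector_derivative
        2 * ?P * ?k n u - (p + q + of_nat n) * ?k (Suc n) u) (at u)"
      by (simp add: algebra_simps)
  qed auto
  have 2: "((\<lambda>u. 2 * ?P * ?k n u - (p + q + of_nat n) * ?k (Suc n) u) has_integral
      2 * ?P * half_beta p q n - (p + q + of_nat n) * half_beta p q (Suc n)) {0..1}"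
    unfolding half_beta_def
    by (intro has_integral_diff has_integral_mult_right integrable_integral integrable_half_beta)
  show ?thesis using has_integral_unique[OF 2 1] by simp
qed

text \<open>On the unit interval u ^ n <= 1, and (2 - u) powr (Re q - 1) <= 1 because 2 - u >= 1.
  Uniformity in n is the point: the remainder of the iterated recurrence then vanishes with its
  coefficient.\<close>

lemma norm_half_beta_le:
  assumes "Re q \<le> 1"
  shows "cmod (half_beta p q n) \<le> integral {0..1} (\<lambda>u. u powr (Re p - 1))"
  unfolding half_beta_def
proof (rule integral_norm_bound_integral[OF integrable_half_beta])
  show "(\<lambda>u. u powr (Re p - 1)) integrable_on {0..1}"
    using p by (intro integrable_on_powr_from_0) auto
  show "cmod (of_real u powr (p + of_nat n - 1) * of_real (2 - u) powr (q - 1)) \<le> u powr (Re p - 1)"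
    if u: "u \<in> {0..1}" for u
  proof (cases "u = 0")
    case False
    have "u powr (Re p + real n - 1) \<le> u powr (Re p - 1)"
      using u False by (intro powr_mono') auto
    moreover have "(2 - u) powr (Re q - 1) \<le> 1"
      using u assms powr_mono2'[of "Re q - 1" 1 "2 - u"] by simp
    ultimately have "u powr (Re p + real n - 1) * (2 - u) powr (Re q - 1) \<le> u powr (Re p - 1) * 1"
      by (intro mult_mono) auto
    then show ?thesis
      using u False norm_powr_pos[of u "p + of_nat n - 1"] norm_powr_pos[of "2 - u" "q - 1"]
      by (simp add: norm_mult)
  qed simp
qed

lemma half_beta_partial_sum:
  "half_beta p q 0 = (\<Sum>k<N. pochhammer (p + q) k / (2 ^ Suc k * pochhammer p (Suc k)))
     + pochhammer (p + q) N / (2 ^ N * pochhammer p N) * half_beta p q N"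
proof (induction N)
  case (Suc N)
  have nz: "p + of_nat k \<noteq> 0" for k using p by (auto simp: complex_eq_iff)
  then have pn: "pochhammer p k \<noteq> 0" for k
    by (metis pochhammer_eq_0_iff add.left_inverse)
  have hN: "half_beta p q N = 1 / (2 * (p + of_nat N)) + (p + q + of_nat N) / (2 * (p + of_nat N)) * half_beta p q (Suc N)"
  proof -
    have "h = 1 / (2 * x) + y / (2 * x) * h'" if "2 * x * h - y * h' = 1" "x \<noteq> 0" for x y h h' :: complex
      using that by (simp add: field_simps)
    from this[OF half_beta_rec nz] show ?thesis .
  qed
  have "pochhammer (p + q) N / (2 ^ N * pochhammer p N) * half_beta p q N =
     pochhammer (p + q) N / (2 ^ Suc N * pochhammer p (Suc N)) +
     pochhammer (p + q) (Suc N) / (2 ^ Suc N * pochhammer p (Suc N)) * half_beta p q (Suc N)"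
  proof -
    have "A / (K * B) * h = A / (2 * K * (B * x)) + A * y / (2 * K * (B * x)) * h'"
      if "h = 1 / (2 * x) + y / (2 * x) * h'" "B \<noteq> 0" "K \<noteq> 0" "x \<noteq> 0" for A B K h h' x y :: complex
      unfolding that(1) using that(2-) by (simp add: field_simps)
    from this[OF hN pn _ nz] show ?thesis unfolding pochhammer_Suc power_Suc by simp
  qed
  with Suc show ?case by simp
qed simp

end

text \<open>With p + q = 1/2 the iterated recurrence has the terms of F(1/2, 1; 1 + p; 1/2) / (2 *
  p), because pochhammer p (Suc k) = p * pochhammer (1 + p) k and pochhammer 1 k cancels fact k. The
  coefficient of the remainder decays geometrically.\<close>

lemma half_beta_hypergeom:
  assumes p: "Re p = 1/4" and q: "q = 1/2 - p"
  shows "half_beta p q 0 = hypergeomF (1/2) 1 (1 + p) (1/2) / (2 * p)"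
proof -
  have p0: "Re p > 0" using p by simp
  have nz: "p + of_nat k \<noteq> 0" for k using p0 by (auto simp: complex_eq_iff)
  have pq: "p + q = 1/2" by (simp add: q)
  define d :: "nat \<Rightarrow> complex" where "d N = pochhammer (1/2) N / (2 ^ N * pochhammer p N)" for N
  have "summable d"
  \<comment> \<open>The ratio is at most (1/2 + n) / (2 * (1/4 + n)), which decreases in n and
    equals 3/5 at n = 1.\<close>
  proof (rule summable_ratio_test[of "3/5" 1])
    fix n :: nat assume n: "n \<ge> 1"
    have "cmod (d (Suc n)) = cmod (1/2 + of_nat n) / (2 * cmod (p + of_nat n)) * cmod (d n)"
      by (simp add: d_def pochhammer_Suc norm_mult norm_divide norm_power mult_ac)
    also have "\<dots> \<le> 3/5 * cmod (d n)"
    proof (rule mult_right_mono)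
      have "cmod (1/2 + of_nat n) = 1/2 + real n"
        using norm_of_real[of "1/2 + real n", where 'a = complex] by simp
      also have "\<dots> \<le> 3/5 * (2 * (1/4 + real n))" using n by simp
      also have "1/4 + real n \<le> cmod (p + of_nat n)"
        using complex_Re_le_cmod[of "p + of_nat n"] p by simp
      finally have "cmod (1/2 + of_nat n) \<le> 3/5 * (2 * cmod (p + of_nat n))" by simp
      then show "cmod (1/2 + of_nat n) / (2 * cmod (p + of_nat n)) \<le> 3/5"
        using nz[of n] by (simp add: divide_simps)
    qed simp
    finally show "cmod (d (Suc n)) \<le> 3/5 * cmod (d n)" .
  qed simp
  then have d0: "d \<longlonglongrightarrow> 0" by (rule summable_LIMSEQ_zero)
  have "(\<lambda>N. d N * half_beta p q N) \<longlonglongrightarrow> 0"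
  proof (rule Lim_null_comparison)
    show "\<forall>\<^sub>F N in sequentially. cmod (d N * half_beta p q N) \<le> cmod (d N) * integral {0..1} (\<lambda>u. u powr (Re p - 1))"
      unfolding norm_mult using p q
      by (intro always_eventually allI mult_left_mono norm_half_beta_le p0) auto
    show "(\<lambda>N. cmod (d N) * integral {0..1} (\<lambda>u. u powr (Re p - 1))) \<longlonglongrightarrow> 0"
      using tendsto_mult_left_zero[OF tendsto_norm_zero[OF d0]] by simp
  qed
  then have "(\<lambda>N. half_beta p q 0 - d N * half_beta p q N) \<longlonglongrightarrow> half_beta p q 0 - 0"
    by (intro tendsto_intros)
  moreover have "half_beta p q 0 - d N * half_beta p q N = (\<Sum>k<N. pochhammer (1/2) k / (2 ^ Suc k * pochhammer p (Suc k)))" for N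
    using half_beta_partial_sum[OF p0, of q N] unfolding pq d_def by simp
  ultimately have "(\<lambda>k. pochhammer (1/2) k / (2 ^ Suc k * pochhammer p (Suc k))) sums half_beta p q 0"
    by (simp add: sums_def)
  from sums_mult[OF this, of "2 * p"]
  have s: "(\<lambda>k. 2 * p * (pochhammer (1/2) k / (2 ^ Suc k * pochhammer p (Suc k)))) sums (2 * p * half_beta p q 0)" .
  have np: "1 + p \<notin> \<int>\<^sub>\<le>\<^sub>0"
  proof
    assume "1 + p \<in> \<int>\<^sub>\<le>\<^sub>0"
    then obtain n where "1 + p = of_int n" "n \<le> 0" by (elim nonpos_Ints_cases)
    then have "Re (1 + p) \<le> 0" by simp
    then show False using p0 by simp
  qed
  then have G0: "Gamma (1 + p) \<noteq> 0" by (simp add: Gamma_eq_zero_iff)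
  have summand: "2 * p * (pochhammer (1/2) k / (2 ^ Suc k * pochhammer p (Suc k))) =
      Gamma (1 + p) * (pochhammer (1/2) k * pochhammer 1 k * (1/2) ^ k / (Gamma (1 + p + of_nat k) * fact k))" for k
  proof -
    have "Gamma (1 + p + of_nat k) = pochhammer (1 + p) k * Gamma (1 + p)"
      using pochhammer_Gamma[OF np, of k] G0 by simp
    moreover have "pochhammer p (Suc k) = p * pochhammer (1 + p) k"
      by (simp add: pochhammer_rec add.commute)
    moreover have "pochhammer 1 k = (fact k :: complex)" by (simp add: pochhammer_fact)
    moreover have "p \<noteq> 0" using nz[of 0] by simp
    ultimately show ?thesis using G0 by (simp add: power_divide)
  qed
  have "(\<lambda>k. pochhammer (1/2) k * pochhammer 1 k * (1/2) ^ k / (Gamma (1 + p + of_nat k) * fact k)) sums (2 * p * half_beta p q 0 / Gamma (1 + p))"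
    using sums_divide[OF s[unfolded summand], of "Gamma (1 + p)"] G0 by simp
  then have "hypergeomF (1/2) 1 (1 + p) (1/2) = 2 * p * half_beta p q 0"
    unfolding hypergeomF_def using G0 by (simp add: sums_iff)
  then show ?thesis using nz[of 0] by simp
qed

text \<open>For s = 1/4 + ia/2 one has 4 * cnj s = 1 - 2ia and 1 + cnj s = 5/4 - ia/2, the prefactor
  and the third parameter in \<open>Y\<close>. They belong to the conjugate of h(0), whence the
  minus sign.\<close>

lemma Y_eq_Im_weber_osc: "Y a = - Im (weber_osc (Complex (1/4) (a / 2)) 0 0) / 2"
proof -
  define s where "s = Complex (1/4) (a / 2)"
  have s: "Re s > 0" "Re (cnj s) = 1/4" "s = 1/2 - cnj s" "1 + cnj s = Complex (5/4) (- a / 2)"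
    "2 * (2 * cnj s) = 1 - 2 * \<i> * of_real a"
    by (simp_all add: s_def complex_eq_iff)
  have "cnj (weber_osc s 0 0) = integral {0..1} (\<lambda>v. cnj (jacobi_weight s (cnj s) v))"
    unfolding weber_osc_zero jacobi_exp_def by (simp add: integral_cnj[symmetric])
  also have "\<dots> = integral {0..1} (\<lambda>v. of_real (1 - v) powr (cnj s + of_nat 0 - 1) * of_real (2 - (1 - v)) powr (s - 1))"
    by (intro Henstock_Kurzweil_Integration.integral_cong, subst cnj_jacobi_weight)
      (simp_all add: jacobi_weight_def mult.commute)
  also have "\<dots> = half_beta (cnj s) s 0"
    unfolding half_beta_def
    by (rule integral_reflect_01[of "\<lambda>u. complex_of_real u powr (cnj s + of_nat 0 - 1) * of_real (2 - u) powr (s - 1)"])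
  also have "\<dots> = hypergeomF (1/2) 1 (1 + cnj s) (1/2) / (2 * cnj s)"
    by (rule half_beta_hypergeom[OF s(2,3)])
  finally have "cnj (weber_osc s 0 0) / 2 = inverse (2 * (2 * cnj s)) * hypergeomF (1/2) 1 (Complex (5/4) (- a / 2)) (1/2)"
    unfolding s(4) by (simp add: field_simps)
  then have "Y a = Im (cnj (weber_osc s 0 0) / 2)"
    by (simp only: Y_def s(5))
  then show ?thesis by (simp add: s_def)
qed

section \<open>Behaviour at infinity\<close>

definition osc_amplitude :: "complex \<Rightarrow> complex" where
  "osc_amplitude s = 2 powr (cnj s - 1) * (Gamma s * exp (- (\<i> * of_real pi / 2 * s)))"

text \<open>The factor that normalizes \<open>weber_osc s n R\<close> to have the limit
  \<open>osc_amplitude s\<close>. It oscillates, so boundary terms are arranged to involve it only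
  through its modulus.\<close>

definition osc_phase :: "complex \<Rightarrow> real \<Rightarrow> complex" where
  "osc_phase s R = of_real (R\<^sup>2 / 4) powr s * exp (- (\<i> * of_real (R\<^sup>2 / 4)))"

lemma norm_osc_phase: "R > 0 \<Longrightarrow> cmod (osc_phase s R) = (R\<^sup>2 / 4) powr Re s"
  using norm_powr_pos[of "R\<^sup>2 / 4" s] by (simp add: osc_phase_def norm_mult)

lemma tendsto_weber_osc:
  assumes "0 < Re s" "Re s < 1"
  shows "((\<lambda>R. osc_phase s R * weber_osc s n R) \<longlongrightarrow> osc_amplitude s) at_top"
proof -
  have "filterlim (\<lambda>R::real. R\<^sup>2 / 4) at_top at_top" by real_asymp
  from filterlim_compose[OF tendsto_jacobi_exp[OF assms] this]
  show ?thesis unfolding osc_amplitude_def osc_phase_def weber_osc_def by (simp only: mult.assoc)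
qed

lemma quarter_square_powr:
  assumes "R > 0"
  shows "(R\<^sup>2 / 4) powr (1/4) = sqrt (R / 2)"
proof -
  have "R\<^sup>2 / 4 = (R / 2) powr 2" using assms by (simp add: power_divide)
  then have "(R\<^sup>2 / 4) powr (1/4) = (R / 2) powr (1/2)" by (simp only: powr_powr) simp
  then show ?thesis using assms by (simp add: powr_half_sqrt)
qed

lemma norm_osc_phase_quarter:
  assumes "R > 0" "Re s = 1/4"
  shows "(cmod (osc_phase s R))\<^sup>2 = R / 2"
  unfolding norm_osc_phase[OF assms(1)] assms(2) quarter_square_powr[OF assms(1)]
  using assms(1) by simp

text \<open>Passing from the even to the odd solution changes the phase by a positive real factor
  only, so one unimodular correction serves both.\<close>

lemma osc_phase_add_half:
  assumes "R > 0"
  shows "osc_phase (s + 1/2) R = osc_phase s R * of_real (R / 2)"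
proof -
  have "complex_of_real (R\<^sup>2 / 4) powr (1/2) = of_real ((R\<^sup>2 / 4) powr (1/2))"
    using powr_of_real[of "R\<^sup>2 / 4" "1/2"] by simp
  also have "(R\<^sup>2 / 4) powr (1/2) = R / 2"
    using assms by (simp add: powr_half_sqrt real_sqrt_divide)
  finally have "complex_of_real (R\<^sup>2 / 4) powr (1/2) = of_real (R / 2)" .
  then show ?thesis
    using assms unfolding osc_phase_def by (subst powr_add) simp
qed

text \<open>If A = B and C = D, the identity Re y * Re z + Im y * Im z = Re (y * cnj z) eliminates
  the unimodular w, which itself need not converge. In general the discrepancy is Im ((A - B) * w) *
  Im (D * w) + Im (B * w) * Im ((D - C) * w), which tends to 0 because the pairs have common
  limits.\<close>

lemma tendsto_Re_mult_cnj_unimodular: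
  fixes A B C D w :: "real \<Rightarrow> complex"
  assumes A: "(A \<longlongrightarrow> Q) at_top" and B: "(B \<longlongrightarrow> Q) at_top"
    and C: "(C \<longlongrightarrow> P) at_top" and D: "(D \<longlongrightarrow> P) at_top"
    and w: "\<forall>\<^sub>F x in at_top. cmod (w x) = 1"
  shows "((\<lambda>x. Re (C x * w x) * Re (B x * w x) + Im (A x * w x) * Im (D x * w x)) \<longlongrightarrow> Re (P * cnj Q)) at_top"
proof -
  have "((\<lambda>x. Im ((A x - B x) * w x) * Im (D x * w x) + Im (B x * w x) * Im ((D x - C x) * w x)) \<longlongrightarrow> 0) at_top"
  proof (rule Lim_null_comparison)
    show "\<forall>\<^sub>F x in at_top. norm (Im ((A x - B x) * w x) * Im (D x * w x) + Im (B x * w x) * Im ((D x - C x) * w x))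
        \<le> cmod (A x - B x) * cmod (D x) + cmod (B x) * cmod (D x - C x)"
      using w
    proof eventually_elim
      case (elim x)
      have "\<bar>Im (z * w x)\<bar> \<le> cmod z" for z
        using abs_Im_le_cmod[of "z * w x"] unfolding norm_mult elim mult_1_right .
      then have "\<bar>Im (y * w x) * Im (z * w x)\<bar> \<le> cmod y * cmod z" for y z
        unfolding abs_mult by (intro mult_mono) auto
      then show ?case
        unfolding real_norm_def by (intro order_trans[OF abs_triangle_ineq] add_mono)
    qed
    have "((\<lambda>x. cmod (A x - B x) * cmod (D x) + cmod (B x) * cmod (D x - C x)) \<longlongrightarrow>
        cmod (Q - Q) * cmod P + cmod Q * cmod (P - P)) at_top"
      by (intro tendsto_intros assms)
    then show "((\<lambda>x. cmod (A x - B x) * cmod (D x) + cmod (B x) * cmod (D x - C x)) \<longlongrightarrow> 0) at_top"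
      by simp
  qed
  moreover have "((\<lambda>x. Re (C x * cnj (B x))) \<longlongrightarrow> Re (P * cnj Q)) at_top"
    by (intro tendsto_intros assms)
  ultimately have lim: "((\<lambda>x. Re (C x * cnj (B x)) + (Im ((A x - B x) * w x) * Im (D x * w x) + Im (B x * w x) * Im ((D x - C x) * w x)))
      \<longlongrightarrow> Re (P * cnj Q) + 0) at_top"
    by (intro tendsto_add)
  show ?thesis
  proof (rule Lim_transform_eventually[OF lim[unfolded add_0_right]])
    show "\<forall>\<^sub>F x in at_top. Re (C x * cnj (B x)) + (Im ((A x - B x) * w x) * Im (D x * w x) + Im (B x * w x) * Im ((D x - C x) * w x)) =
       Re (C x * w x) * Re (B x * w x) + Im (A x * w x) * Im (D x * w x)"
      using w
    proof eventually_elim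
      case (elim x)
      have "C x * cnj (B x) = (C x * w x) * cnj (B x * w x)"
        using complex_norm_square[of "w x"] elim by (simp add: mult_ac)
      moreover have "Re (y * cnj z) = Re y * Re z + Im y * Im z" for y z by simp
      ultimately have "Re (C x * cnj (B x)) = Re (C x * w x) * Re (B x * w x) + Im (C x * w x) * Im (B x * w x)"
        by (simp only:)
      then show ?case by (simp only: left_diff_distrib minus_complex.sel) (simp add: right_diff_distrib left_diff_distrib mult.commute)
    qed
  qed
qed

text \<open>The factor R / 2 in the Wronskian is exactly the squared modulus of the phase, so it
  normalizes both moments at once; as they share their limit, the product tends to a squared
  modulus.\<close>

lemma tendsto_integral_Re_weber_osc:
  fixes a :: real
  defines "s \<equiv> Complex (1/4) (a / 2)"
  shows "((\<lambda>R. integral {0..R} (\<lambda>x. Re (weber_osc s 0 x))) \<longlongrightarrow> (cmod (osc_amplitude s))\<^sup>2) at_top"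
proof -
  have s: "0 < Re s" "Re s < 1" "Re s = 1/4" by (simp_all add: s_def)
  have "((\<lambda>R. Re ((osc_phase s R * weber_osc s 0 R) * cnj (osc_phase s R * weber_osc s (Suc 0) R))) \<longlongrightarrow>
     Re (osc_amplitude s * cnj (osc_amplitude s))) at_top"
    by (intro tendsto_intros tendsto_weber_osc s)
  moreover have "\<forall>\<^sub>F R in at_top. Re ((osc_phase s R * weber_osc s 0 R) * cnj (osc_phase s R * weber_osc s (Suc 0) R)) =
     integral {0..R} (\<lambda>x. Re (weber_osc s 0 x))"
    using eventually_gt_at_top[of 0]
  proof eventually_elim
    case (elim R)
    have "osc_phase s R * weber_osc s 0 R * cnj (osc_phase s R * weber_osc s (Suc 0) R) =
        (osc_phase s R * cnj (osc_phase s R)) * (weber_osc s 0 R * cnj (weber_osc s (Suc 0) R))"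
      by (simp add: mult_ac)
    also have "osc_phase s R * cnj (osc_phase s R) = of_real (R / 2)"
      unfolding complex_norm_square[symmetric] norm_osc_phase_quarter[OF elim s(3)] ..
    finally have "osc_phase s R * weber_osc s 0 R * cnj (osc_phase s R * weber_osc s (Suc 0) R) =
        of_real (R / 2) * (weber_osc s 0 R * cnj (weber_osc s (Suc 0) R))" .
    moreover have "Re (of_real r * z) = r * Re z" for r z by simp
    moreover have "integral {0..R} (\<lambda>x. Re (weber_osc s 0 x)) = R / 2 * Re (weber_osc s 0 R * cnj (weber_osc s (Suc 0) R))"
      unfolding s_def using elim by (intro integral_Re_weber_osc) simp
    ultimately show ?case by (simp only:)
  qed
  ultimately have "((\<lambda>R. integral {0..R} (\<lambda>x. Re (weber_osc s 0 x))) \<longlongrightarrow> Re (osc_amplitude s * cnj (osc_amplitude s))) at_top"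
    by (rule Lim_transform_eventually)
  then show ?thesis by (simp only: complex_norm_square[symmetric] Re_complex_of_real)
qed

lemma tendsto_integral_Re_weber_osc_odd:
  fixes a :: real
  defines "s \<equiv> Complex (1/4) (a / 2)" and "q \<equiv> Complex (3/4) (a / 2)"
  shows "((\<lambda>R. integral {0..R} (\<lambda>x. x * Re (weber_osc q 0 x))) \<longlongrightarrow>
    2 * Re (osc_amplitude q * cnj (osc_amplitude s)) + Im (weber_osc s 0 0) * Re (weber_osc q 0 0)) at_top"
proof -
  have s: "0 < Re s" "Re s < 1" "Re s = 1/4" by (simp_all add: s_def)
  have q: "0 < Re q" "Re q < 1" "q = s + 1/2" by (simp_all add: q_def s_def complex_eq_iff)
  \<comment> \<open>Dividing by the phase and restoring its modulus: \<open>w\<close> is unimodular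
    and undoes the oscillation introduced by \<open>osc_phase\<close>.\<close>
  define w where "w R = of_real (sqrt (R / 2)) / osc_phase s R" for R
  have nw: "cmod (osc_phase s R) = sqrt (R / 2)" if "R > 0" for R
    using norm_osc_phase[OF that, of s] s(3) quarter_square_powr[OF that] by simp
  have w1: "\<forall>\<^sub>F R in at_top. cmod (w R) = 1"
    using eventually_gt_at_top[of 0]
    by eventually_elim (simp add: w_def norm_divide nw)
  let ?e = "\<lambda>n R. osc_phase s R * weber_osc s n R"
  let ?c = "\<lambda>n R. osc_phase q R * weber_osc q n R"
  have main: "((\<lambda>R. Re (?c 0 R * w R) * Re (?e (Suc 0) R * w R) + Im (?e 0 R * w R) * Im (?c (Suc 0) R * w R)) \<longlongrightarrow>
      Re (osc_amplitude q * cnj (osc_amplitude s))) at_top"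
    by (intro tendsto_Re_mult_cnj_unimodular tendsto_weber_osc s q(1,2) w1)
  \<comment> \<open>The boundary term without the factor R^2 is, after normalization, smaller than
    the others by 4 / R^2.\<close>
  have small: "((\<lambda>R. 4 / R\<^sup>2 * (Im (?e 0 R * w R) * Re (?c 0 R * w R))) \<longlongrightarrow> 0) at_top"
  proof (rule Lim_null_comparison)
    show "\<forall>\<^sub>F R in at_top. norm (4 / R\<^sup>2 * (Im (?e 0 R * w R) * Re (?c 0 R * w R))) \<le> 4 / R\<^sup>2 * (cmod (?e 0 R) * cmod (?c 0 R))"
      using w1
    proof eventually_elim
      case (elim R)
      have "\<bar>Im (z * w R)\<bar> \<le> cmod z" "\<bar>Re (z * w R)\<bar> \<le> cmod z" for z
        using abs_Im_le_cmod[of "z * w R"] abs_Re_le_cmod[of "z * w R"] unfolding norm_mult elim mult_1_right .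
      then have b: "\<bar>Im (y * w R)\<bar> * \<bar>Re (z * w R)\<bar> \<le> cmod y * cmod z" for y z
        by (intro mult_mono) auto
      show ?case unfolding real_norm_def abs_mult by (intro mult_mono[OF _ b]) simp_all
    qed
    have "((\<lambda>R::real. 4 / R\<^sup>2) \<longlongrightarrow> 0) at_top" by real_asymp
    then have "((\<lambda>R. 4 / R\<^sup>2 * (cmod (?e 0 R) * cmod (?c 0 R))) \<longlongrightarrow> 0 * (cmod (osc_amplitude s) * cmod (osc_amplitude q))) at_top"
      by (intro tendsto_mult tendsto_norm tendsto_weber_osc s q(1,2))
    then show "((\<lambda>R. 4 / R\<^sup>2 * (cmod (?e 0 R) * cmod (?c 0 R))) \<longlongrightarrow> 0) at_top" by simp
  qed
  have "((\<lambda>R. 2 * (Re (?c 0 R * w R) * Re (?e (Suc 0) R * w R) + Im (?e 0 R * w R) * Im (?c (Suc 0) R * w R))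
     - 4 / R\<^sup>2 * (Im (?e 0 R * w R) * Re (?c 0 R * w R)) + Im (weber_osc s 0 0) * Re (weber_osc q 0 0)) \<longlongrightarrow>
      2 * Re (osc_amplitude q * cnj (osc_amplitude s)) - 0 + Im (weber_osc s 0 0) * Re (weber_osc q 0 0)) at_top"
    by (intro tendsto_add tendsto_diff tendsto_mult tendsto_const main small)
  moreover have "\<forall>\<^sub>F R in at_top. 2 * (Re (?c 0 R * w R) * Re (?e (Suc 0) R * w R) + Im (?e 0 R * w R) * Im (?c (Suc 0) R * w R))
     - 4 / R\<^sup>2 * (Im (?e 0 R * w R) * Re (?c 0 R * w R)) + Im (weber_osc s 0 0) * Re (weber_osc q 0 0) =
     integral {0..R} (\<lambda>x. x * Re (weber_osc q 0 x))"
    using eventually_gt_at_top[of 0]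
  proof eventually_elim
    case (elim R)
    \<comment> \<open>The normalized even and odd moments carry the real factors b and b * (R / 2).
      Their product is R^2 / 4, half of the factor in the Wronskian, which explains the 2 in the
      limit.\<close>
    define b where "b = sqrt (R / 2)"
    have b: "b > 0" "b * b = R / 2" using elim by (simp_all add: b_def)
    have ph: "osc_phase s R \<noteq> 0" using nw[OF elim] elim by auto
    have e: "?e n R * w R = of_real b * weber_osc s n R" for n
      using ph by (simp add: w_def b_def)
    have c: "?c n R * w R = of_real (b * (R / 2)) * weber_osc q n R" for n
      using ph by (simp add: w_def b_def q(3) osc_phase_add_half[OF elim])
    have "integral {0..R} (\<lambda>x. x * Re (weber_osc q 0 x)) =
      R\<^sup>2 / 2 * (Re (weber_osc q 0 R) * Re (weber_osc s (Suc 0) R) + Im (weber_osc s 0 R) * Im (weber_osc q (Suc 0) R))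
      - Im (weber_osc s 0 R) * Re (weber_osc q 0 R) + Im (weber_osc s 0 0) * Re (weber_osc q 0 0)"
      unfolding s_def q_def by (rule integral_Re_weber_osc_odd) (use elim in simp)
    moreover have "Re (of_real x * z) = x * Re z" "Im (of_real x * z) = x * Im z" for x z by simp_all
    moreover have "2 * (b * (R / 2) * x * (b * y) + b * z * (b * (R / 2) * u)) - 4 / R\<^sup>2 * (b * z * (b * (R / 2) * x))
       = R\<^sup>2 / 2 * (x * y + z * u) - z * x" for x y z u
    proof -
      have "2 * (b * (R / 2) * x * (b * y) + b * z * (b * (R / 2) * u)) - 4 / R\<^sup>2 * (b * z * (b * (R / 2) * x))
        = (b * b) * R * (x * y + z * u) - (b * b) * (2 / R) * (z * x)"
        using elim by (simp add: field_simps power2_eq_square)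
      then show ?thesis unfolding b(2) using elim by (simp add: field_simps power2_eq_square)
    qed
    ultimately show ?case unfolding e c by (simp only:)
  qed
  ultimately show ?thesis by (simp add: Lim_transform_eventually)
qed

section \<open>Closed forms of the amplitudes\<close>

text \<open>Power of 2 and Gamma modulus agree with those in \<open>Re_weber_osc_zero\<close>, so
  the quotient of the two, which is the integral of the even solution when c = 1/4, is just Gamma (2
  * c) * exp (pi * b).\<close>

lemma norm_osc_amplitude_square:
  "(cmod (osc_amplitude (Complex c b)))\<^sup>2 = 2 powr (2 * c - 2) * (cmod (Gamma (Complex c b)))\<^sup>2 * exp (pi * b)"
proof -
  have "cmod (2 powr (cnj (Complex c b) - 1)) = 2 powr (c - 1)"
    using norm_powr_pos[of 2 "cnj (Complex c b) - 1"] by simp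
  moreover have "(2 powr (c - 1))\<^sup>2 = 2 powr (2 * c - 2)"
    by (simp add: power2_eq_square powr_add[symmetric])
  moreover have "cmod (exp (- (\<i> * of_real pi / 2 * Complex c b))) = exp (pi * b / 2)"
    by simp
  moreover have "(exp (pi * b / 2))\<^sup>2 = exp (pi * b)"
    by (simp add: power2_eq_square exp_add[symmetric])
  ultimately show ?thesis
    by (simp add: osc_amplitude_def norm_mult power_mult_distrib)
qed

lemma sin_three_quarters:
  "sin (Complex (3 * pi / 4) y) = of_real (1 / sqrt 2) * Complex (cosh y) (- sinh y)"
proof -
  have e: "sqrt 2 / 2 = 1 / sqrt 2" by (simp add: field_simps)
  have "3 * pi / 4 = pi - pi / 4" by simp
  then have "sin (3 * pi / 4) = 1 / sqrt 2" "cos (3 * pi / 4) = - (1 / sqrt 2)"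
    by (simp_all only: sin_pi_minus cos_pi_minus sin_45 cos_45 e)
  then show ?thesis
    by (simp add: complex_eq_iff Re_sin Im_sin cosh_field_def sinh_field_def field_simps)
qed

text \<open>Conjugation replaces 1/4 + ib by 1/4 - ib = 1 - (3/4 + ib) without changing the modulus,
  after which the reflection formula applies.\<close>

lemma norm_Gamma_quarter_mult:
  "cmod (Gamma (Complex (1/4) b)) * cmod (Gamma (Complex (3/4) b)) = sqrt 2 * pi / sqrt (cosh (2 * pi * b))"
proof -
  define q where "q = Complex (3/4) b"
  have "1 - q = cnj (Complex (1/4) b)" by (simp add: q_def complex_eq_iff)
  then have "cmod (Gamma (Complex (1/4) b)) = cmod (Gamma (1 - q))"
    by (metis cnj_Gamma complex_mod_cnj)
  then have "cmod (Gamma (Complex (1/4) b)) * cmod (Gamma (Complex (3/4) b)) = cmod (Gamma q * Gamma (1 - q))"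
    by (simp add: q_def norm_mult)
  also have "\<dots> = pi / cmod (sin (of_real pi * q))"
    by (simp add: Gamma_reflection_complex norm_divide)
  also have "of_real pi * q = Complex (3 * pi / 4) (pi * b)" by (simp add: q_def complex_eq_iff)
  also have "cmod (sin (Complex (3 * pi / 4) (pi * b))) = sqrt (cosh (2 * pi * b) / 2)"
    unfolding sin_three_quarters norm_mult
    using cosh_double[of "pi * b"] by (simp add: cmod_def real_sqrt_divide mult.assoc)
  finally show ?thesis by (simp add: real_sqrt_divide)
qed

text \<open>Since cnj s = 1 - q, the conjugated amplitude contains Gamma (1 - q): the reflection
  formula evaluates the product itself, not only its modulus, and the powers of 2 multiply to
  1/2.\<close>

lemma Re_osc_amplitude_mult:
  "Re (osc_amplitude (Complex (3/4) b) * cnj (osc_amplitude (Complex (1/4) b))) =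
    pi / 2 * exp (2 * pi * b) / cosh (2 * pi * b)"
proof -
  define s q where "s = Complex (1/4) b" and "q = Complex (3/4) b"
  have sq: "cnj s = 1 - q" "(cnj q - 1) + (s - 1) = -1" by (simp_all add: q_def s_def complex_eq_iff)
  have "osc_amplitude q * cnj (osc_amplitude s) =
     (2 powr (cnj q - 1) * 2 powr (s - 1)) * (Gamma q * Gamma (1 - q)) *
     (exp (- (\<i> * of_real pi / 2 * q)) * exp (\<i> * of_real pi / 2 * cnj s))"
    unfolding osc_amplitude_def sq(1)[symmetric]
    by (simp add: cnj_powr exp_cnj cnj_Gamma mult_ac)
  also have "2 powr (cnj q - 1) * 2 powr (s - 1) = (1 / 2 :: complex)"
  proof -
    have "2 powr (cnj q - 1) * 2 powr (s - 1) = (2 :: complex) powr ((cnj q - 1) + (s - 1))"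
      by (subst powr_add) simp
    then show ?thesis unfolding sq(2) by (simp add: powr_minus_divide)
  qed
  also have "Gamma q * Gamma (1 - q) = of_real pi / sin (of_real pi * q)"
    by (rule Gamma_reflection_complex)
  also have "of_real pi * q = Complex (3 * pi / 4) (pi * b)" by (simp add: q_def complex_eq_iff)
  \<comment> \<open>The exponents add up to pi * b - i * pi / 4; the resulting 1 / sqrt 2 cancels
    against the one in the sine.\<close>
  also have "exp (- (\<i> * of_real pi / 2 * q)) * exp (\<i> * of_real pi / 2 * cnj s) =
     of_real (exp (pi * b)) * Complex (1 / sqrt 2) (- 1 / sqrt 2)"
  proof -
    have "- (\<i> * of_real pi / 2 * q) + \<i> * of_real pi / 2 * cnj s = Complex (pi * b) (- pi / 4)"
      by (simp add: q_def s_def complex_eq_iff field_simps)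
    then have "exp (- (\<i> * of_real pi / 2 * q)) * exp (\<i> * of_real pi / 2 * cnj s) = exp (Complex (pi * b) (- pi / 4))"
      by (metis exp_add)
    also have "\<dots> = of_real (exp (pi * b)) * Complex (1 / sqrt 2) (- 1 / sqrt 2)"
      by (simp add: complex_eq_iff Re_exp Im_exp cos_45 sin_45 real_div_sqrt field_simps)
    finally show ?thesis .
  qed
  also have "1 / 2 * (of_real pi / sin (Complex (3 * pi / 4) (pi * b))) * (of_real (exp (pi * b)) * Complex (1 / sqrt 2) (- 1 / sqrt 2))
     = of_real (pi / 2 * exp (pi * b)) * (Complex 1 (- 1) / Complex (cosh (pi * b)) (- sinh (pi * b)))"
  proof -
    have "Complex (1 / sqrt 2) (- 1 / sqrt 2) = of_real (1 / sqrt 2) * Complex 1 (- 1)"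
      by (simp add: complex_eq_iff)
    then show ?thesis unfolding sin_three_quarters by simp
  qed
  finally have "osc_amplitude q * cnj (osc_amplitude s) = of_real (pi / 2 * exp (pi * b)) *
    (Complex 1 (- 1) / Complex (cosh (pi * b)) (- sinh (pi * b)))" .
  moreover have "Re (of_real r * z) = r * Re z" for r z by simp
  ultimately have "Re (osc_amplitude q * cnj (osc_amplitude s)) =
      pi / 2 * exp (pi * b) * Re (Complex 1 (- 1) / Complex (cosh (pi * b)) (- sinh (pi * b)))"
    by (simp only:)
  also have "Re (Complex 1 (- 1) / Complex (cosh (pi * b)) (- sinh (pi * b))) = exp (pi * b) / cosh (2 * pi * b)"
    using cosh_double[of "pi * b"] by (simp add: Re_divide power2_eq_square cosh_plus_sinh mult.assoc)
  finally show ?thesis by (simp add: s_def q_def exp_add[symmetric])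
qed

section \<open>Integrals of the Weber functions and the connection coefficients\<close>

lemma weber_G_pos: "weber_G1 a > 0" "weber_G3 a > 0"
proof -
  have "Gamma (Complex c b) \<noteq> 0" if "c > 0" for c b
  proof -
    have "Complex c b \<notin> \<int>\<^sub>\<le>\<^sub>0"
      using that by (auto elim!: nonpos_Ints_cases simp: complex_eq_iff)
    then show ?thesis by (simp add: Gamma_eq_zero_iff)
  qed
  then show "weber_G1 a > 0" "weber_G3 a > 0"
    by (simp_all add: weber_G1_def weber_G3_def)
qed

lemma Re_weber_osc_quarter_zero:
  "Re (weber_osc (Complex (1/4) (a / 2)) 0 0) = 2 powr (- 3/2) * (weber_G1 a)\<^sup>2 / sqrt pi"
  using Re_weber_osc_zero[of "1/4" "a / 2"] by (simp add: weber_G1_def Gamma_one_half_real)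

lemma Re_weber_osc_three_quarters_zero:
  "Re (weber_osc (Complex (3/4) (a / 2)) 0 0) = sqrt 2 * (weber_G3 a)\<^sup>2 / sqrt pi"
proof -
  have "(1 / 2 :: real) \<notin> \<int>\<^sub>\<le>\<^sub>0"
  proof
    assume "(1 / 2 :: real) \<in> \<int>\<^sub>\<le>\<^sub>0"
    then obtain n where "1 / 2 = real_of_int n" "n \<le> 0" by (elim nonpos_Ints_cases)
    then show False by linarith
  qed
  then have g: "Gamma (3 / 2 :: real) = sqrt pi / 2"
    using Gamma_plus1[of "1/2 :: real"] by (simp add: Gamma_one_half_real)
  have "2 powr - (1 / 2) = sqrt 2 / (2 :: real)"
    by (simp add: powr_minus powr_half_sqrt field_simps)
  then show ?thesis
    using Re_weber_osc_zero[of "3/4" "a / 2"] by (simp add: weber_G3_def g)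
qed

context
  fixes a :: real
begin

definition "osc1 = weber_osc (Complex (1/4) (a / 2))"
definition "osc3 = weber_osc (Complex (3/4) (a / 2))"

lemma weber_w_eq:
  shows weber_w1_eq: "weber_w1 a x = Re (osc1 0 x) / Re (osc1 0 0)"
    and weber_w2_eq: "weber_w2 a x = x * Re (osc3 0 x) / Re (osc3 0 0)"
    and Re_osc1_pos: "Re (osc1 0 0) > 0"
    and Re_osc3_pos: "Re (osc3 0 0) > 0"
proof -
  show p: "Re (osc1 0 0) > 0" "Re (osc3 0 0) > 0"
    using weber_G_pos[of a]
    by (simp_all add: osc1_def osc3_def Re_weber_osc_quarter_zero Re_weber_osc_three_quarters_zero)
  show "weber_w1 a x = Re (osc1 0 x) / Re (osc1 0 0)"
    using weber_w1_integral[of a x] p by (simp add: osc1_def)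
  show "weber_w2 a x = x * Re (osc3 0 x) / Re (osc3 0 0)"
    using weber_w2_integral[of a x] p by (simp add: osc3_def)
qed

lemma weber_w_minus: "weber_w1 a (- x) = weber_w1 a x" "weber_w2 a (- x) = - weber_w2 a x"
  by (simp_all add: weber_w1_eq weber_w2_eq osc1_def osc3_def weber_osc_def)

lemma DERIV_weber_w1:
  "(weber_w1 a has_real_derivative - (x / 2 * Im (osc1 (Suc 0) x)) / Re (osc1 0 0)) (at x)"
proof -
  have "((\<lambda>x. Re (osc1 0 x)) has_real_derivative - (x / 2 * Im (osc1 (Suc 0) x))) (at x)"
    using has_real_derivative_Re[OF has_vector_derivative_weber_osc[of "Complex (1/4) (a / 2)" 0 x UNIV]]
    by (simp add: osc1_def)
  from DERIV_cdivide[OF this, of "Re (osc1 0 0)"] show ?thesis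
    by (simp add: weber_w1_eq[abs_def])
qed

lemma DERIV_weber_w2:
  "(weber_w2 a has_real_derivative
     (Re (osc3 0 x) - x * (x / 2 * Im (osc3 (Suc 0) x))) / Re (osc3 0 0)) (at x)"
proof -
  have "((\<lambda>x. Re (osc3 0 x)) has_real_derivative - (x / 2 * Im (osc3 (Suc 0) x))) (at x)"
    using has_real_derivative_Re[OF has_vector_derivative_weber_osc[of "Complex (3/4) (a / 2)" 0 x UNIV]]
    by (simp add: osc3_def)
  from DERIV_cdivide[OF DERIV_mult[OF DERIV_ident this], of "Re (osc3 0 0)"] show ?thesis
    by (simp add: weber_w2_eq[abs_def] algebra_simps)
qed

lemma tendsto_integral_weber_w1:
  "((\<lambda>R. integral {0..R} (weber_w1 a)) \<longlongrightarrow> sqrt pi * exp (pi * a / 2)) at_top"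
proof -
  have "((\<lambda>R. integral {0..R} (\<lambda>x. Re (osc1 0 x)) / Re (osc1 0 0)) \<longlongrightarrow>
     (cmod (osc_amplitude (Complex (1/4) (a / 2))))\<^sup>2 / Re (osc1 0 0)) at_top"
    unfolding osc1_def using Re_osc1_pos
    by (intro tendsto_divide tendsto_const tendsto_integral_Re_weber_osc) (simp add: osc1_def)
  moreover have "integral {0..R} (\<lambda>x. Re (osc1 0 x)) / Re (osc1 0 0) = integral {0..R} (weber_w1 a)" for R
    by (simp add: weber_w1_eq[abs_def])
  moreover have "(cmod (osc_amplitude (Complex (1/4) (a / 2))))\<^sup>2 / Re (osc1 0 0) = sqrt pi * exp (pi * a / 2)"
    using weber_G_pos[of a]
    unfolding norm_osc_amplitude_square osc1_def Re_weber_osc_quarter_zero weber_G1_def[symmetric]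
    by simp
  ultimately show ?thesis by simp
qed

text \<open>The boundary term at 0 contributes - 2 * Y a. In the other term the squared
  \<open>weber_G3 a\<close> from the normalization is traded for the quotient of
  \<open>weber_G1 a\<close> and \<open>weber_G3 a\<close> through their known product, and 1 + exp
  (- 2 * pi * a) = 2 * cosh (pi * a) * exp (- pi * a) absorbs the hyperbolic cosine.\<close>

lemma tendsto_integral_weber_w2:
  "((\<lambda>R. integral {0..R} (weber_w2 a)) \<longlongrightarrow>
     sqrt pi * exp (pi * a / 2) * (1 + exp (- 2 * pi * a)) powr (- 1 / 2) * (weber_G1 a / (sqrt 2 * weber_G3 a)) - 2 * Y a) at_top"
proof -
  let ?Q = "Re (osc_amplitude (Complex (3/4) (a / 2)) * cnj (osc_amplitude (Complex (1/4) (a / 2))))"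
  let ?C = "cosh (pi * a)"
  have "((\<lambda>R. integral {0..R} (\<lambda>x. x * Re (osc3 0 x)) / Re (osc3 0 0)) \<longlongrightarrow>
     (2 * ?Q + Im (osc1 0 0) * Re (osc3 0 0)) / Re (osc3 0 0)) at_top"
    unfolding osc3_def osc1_def using Re_osc3_pos
    by (intro tendsto_divide tendsto_const tendsto_integral_Re_weber_osc_odd) (simp add: osc3_def)
  moreover have "integral {0..R} (\<lambda>x. x * Re (osc3 0 x)) / Re (osc3 0 0) = integral {0..R} (weber_w2 a)" for R
    by (simp add: weber_w2_eq[abs_def])
  moreover have "(2 * ?Q + Im (osc1 0 0) * Re (osc3 0 0)) / Re (osc3 0 0) = 2 * ?Q / Re (osc3 0 0) - 2 * Y a"
    using Re_osc3_pos Y_eq_Im_weber_osc[of a] by (simp add: osc1_def add_divide_distrib)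
  moreover have "2 * ?Q / Re (osc3 0 0) =
     sqrt pi * exp (pi * a / 2) * (1 + exp (- 2 * pi * a)) powr (- 1 / 2) * (weber_G1 a / (sqrt 2 * weber_G3 a))"
  proof -
    have C: "?C > 0" by simp
    have "1 + exp (- 2 * pi * a) = 2 * ?C * exp (- (pi * a))"
      by (simp add: cosh_field_def algebra_simps exp_add[symmetric])
    then have "(1 + exp (- 2 * pi * a)) powr (- 1 / 2) = inverse (sqrt (2 * ?C * exp (- (pi * a))))"
      using powr_half_sqrt[of "2 * ?C * exp (- (pi * a))"] powr_minus[of "2 * ?C * exp (- (pi * a))" "1/2"] by simp
    also have "sqrt (2 * ?C * exp (- (pi * a))) = sqrt 2 * sqrt ?C * exp (- (pi * a) / 2)"
    proof -
      have "exp (- (pi * a)) = (exp (- (pi * a) / 2))\<^sup>2"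
        by (simp add: power2_eq_square exp_add[symmetric])
      then show ?thesis by (simp add: real_sqrt_mult)
    qed
    finally have P: "(1 + exp (- 2 * pi * a)) powr (- 1 / 2) = exp (pi * a / 2) / (sqrt 2 * sqrt ?C)"
      by (simp add: exp_minus field_simps)
    have "weber_G1 a * weber_G3 a = sqrt 2 * pi / sqrt ?C"
      using norm_Gamma_quarter_mult[of "a / 2"] by (simp add: weber_G1_def weber_G3_def)
    then have G: "weber_G1 a = sqrt 2 * pi / (sqrt ?C * weber_G3 a)"
      using weber_G_pos(2)[of a] by (simp add: field_simps)
    have E: "exp (pi * a) = exp (pi * a / 2) * exp (pi * a / 2)"
      by (simp add: exp_add[symmetric])
    have Q: "?Q = pi / 2 * exp (pi * a) / ?C"
      using Re_osc_amplitude_mult[of "a / 2"] by simp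
    have sq: "sqrt ?C * (sqrt ?C * z) = ?C * z" "sqrt 2 * (sqrt 2 * z) = 2 * z" "sqrt pi * (sqrt pi * z) = pi * z" for z
      using C by (simp_all add: mult.assoc[symmetric])
    show ?thesis
      unfolding Q P G E osc3_def Re_weber_osc_three_quarters_zero
      using weber_G_pos(2)[of a] C by (simp add: field_simps power2_eq_square sq)
  qed
  ultimately show ?thesis by simp
qed

end

section \<open>Improper integrals and the connection coefficients\<close>

text \<open>The base point -1 instead of 0 makes one formula valid on both sides of 0, as the
  two-sided derivative at 0 requires.\<close>

lemma int_to_infty_eq:
  fixes f :: "real \<Rightarrow> real"
  assumes f: "continuous_on UNIV f"
    and L: "((\<lambda>R. integral {0..R} f) \<longlongrightarrow> L) at_top" and x: "x > -1"
  shows "int_to_infty f x = L + integral {-1..0} f - integral {-1..x} f"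
  unfolding int_to_infty_def
proof (rule tendsto_Lim)
  have i: "f integrable_on {u..v}" for u v
    using f by (meson continuous_on_subset integrable_continuous_real subset_UNIV)
  have "((\<lambda>R. integral {0..R} f + integral {-1..0} f - integral {-1..x} f) \<longlongrightarrow>
      L + integral {-1..0} f - integral {-1..x} f) at_top"
    by (intro tendsto_intros L)
  moreover have "\<forall>\<^sub>F R in at_top. integral {0..R} f + integral {-1..0} f - integral {-1..x} f = integral {x..R} f"
    using eventually_ge_at_top[of "max x 0"]
  proof eventually_elim
    case (elim R)
    have "integral {-1..0} f + integral {0..R} f = integral {-1..R} f"
      using elim by (intro Henstock_Kurzweil_Integration.integral_combine i) auto
    moreover have "integral {-1..x} f + integral {x..R} f = integral {-1..R} f"
      using elim x by (intro Henstock_Kurzweil_Integration.integral_combine i) auto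
    ultimately show ?case by simp
  qed
  ultimately show "((\<lambda>R. integral {x..R} f) \<longlongrightarrow> L + integral {-1..0} f - integral {-1..x} f) at_top"
    by (rule Lim_transform_eventually)
qed simp

lemma int_to_infty_zero:
  fixes f :: "real \<Rightarrow> real"
  assumes "continuous_on UNIV f" "((\<lambda>R. integral {0..R} f) \<longlongrightarrow> L) at_top"
  shows "int_to_infty f 0 = L"
  using int_to_infty_eq[OF assms, of 0] by simp

lemma DERIV_int_to_infty:
  fixes f :: "real \<Rightarrow> real"
  assumes f: "continuous_on UNIV f" and L: "((\<lambda>R. integral {0..R} f) \<longlongrightarrow> L) at_top"
  shows "(int_to_infty f has_real_derivative - f 0) (at 0)"
proof -
  have "((\<lambda>x. integral {-1..x} f) has_real_derivative f 0) (at 0 within {-1..1})"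
    using f by (intro integral_has_real_derivative) (auto intro: continuous_on_subset)
  then have "((\<lambda>x. integral {-1..x} f) has_real_derivative f 0) (at 0)"
    by (simp add: at_within_Icc_at)
  then have "((\<lambda>x. L + integral {-1..0} f - integral {-1..x} f) has_real_derivative 0 - f 0) (at 0)"
    by (intro DERIV_diff DERIV_const)
  then have d: "((\<lambda>x. L + integral {-1..0} f - integral {-1..x} f) has_real_derivative - f 0) (at 0)"
    by simp
  show ?thesis
  proof (rule has_field_derivative_transform_within_open[OF d])
    show "open {-1<..<1::real}" "0 \<in> {-1<..<1::real}" by auto
    show "L + integral {-1..0} f - integral {-1..x} f = int_to_infty f x" if "x \<in> {-1<..<1}" for x
      using int_to_infty_eq[OF f L, of x] that by simp
  qed
qed

text \<open>By parity the value of \<open>NW_hat a\<close> at 0 is 2 * A * B * M2 and its derivative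
  there is - 2 * A * B * M1, with M1 and M2 the integrals of the even and odd solutions; since A * B
  = 1/2 these are M2 and - M1.\<close>

lemma weber_connection_coefficients:
  fixes a :: real
  defines "A \<equiv> W a 0" and "B \<equiv> - deriv (W a) 0"
    and "M1 \<equiv> sqrt pi * exp (pi * a / 2)"
    and "S \<equiv> sqrt pi * exp (pi * a / 2) * (1 + exp (- 2 * pi * a)) powr (- 1 / 2)"
  shows W_zero: "A = 2 powr (- 3/4) * sqrt (weber_G1 a / weber_G3 a)"
    and deriv_W_zero: "B = 2 powr (- 1/4) * sqrt (weber_G3 a / weber_G1 a)"
    and c0_plus_eq: "c0_plus a = A * (M1 + S - 4 * Y a * B\<^sup>2)"
    and c0_minus_eq: "c0_minus a = A * (S - M1 - 4 * Y a * B\<^sup>2)"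
proof -
  define A' where "A' = 2 powr (- 3/4) * sqrt (weber_G1 a / weber_G3 a)"
  define B' where "B' = 2 powr (- 3/4) * sqrt (2 * weber_G3 a / weber_G1 a)"
  note G = weber_G_pos[of a]
  have Wx: "W a x = A' * weber_w1 a x - B' * weber_w2 a x" for x
    by (simp add: W_def A'_def B'_def algebra_simps)
  have Wm: "W a (- x) = A' * weber_w1 a x + B' * weber_w2 a x" for x
    unfolding Wx by (simp add: weber_w_minus)
  have w0: "weber_w1 a 0 = 1" "weber_w2 a 0 = 0"
    using Re_osc1_pos[of a] by (simp_all add: weber_w1_eq weber_w2_eq)
  have d1: "(weber_w1 a has_real_derivative 0) (at 0)"
    using DERIV_weber_w1[of a 0] by simp
  have d2: "(weber_w2 a has_real_derivative 1) (at 0)"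
    using DERIV_weber_w2[of a 0] Re_osc3_pos[of a] by simp
  have c: "continuous_on UNIV (weber_w1 a)" "continuous_on UNIV (weber_w2 a)"
    using DERIV_weber_w1 DERIV_weber_w2 by (meson DERIV_isCont continuous_at_imp_continuous_on)+
  have dW: "(W a has_real_derivative - B') (at 0)"
    using DERIV_diff[OF DERIV_cmult[OF d1, of A'] DERIV_cmult[OF d2, of B']] by (simp add: Wx[abs_def])
  have dWm: "((\<lambda>x. W a (- x)) has_real_derivative B') (at 0)"
    using DERIV_add[OF DERIV_cmult[OF d1, of A'] DERIV_cmult[OF d2, of B']] by (simp add: Wm)
  have A: "A = A'" by (simp add: A_def Wx w0)
  have B: "B = B'" using DERIV_imp_deriv[OF dW] by (simp add: B_def)
  show "A = 2 powr (- 3/4) * sqrt (weber_G1 a / weber_G3 a)"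
    by (simp add: A A'_def)
  have p2: "2 powr (- 1/4) = 2 powr (- 3/4) * sqrt (2 :: real)"
    by (simp add: powr_half_sqrt[symmetric] powr_add[symmetric])
  show "B = 2 powr (- 1/4) * sqrt (weber_G3 a / weber_G1 a)"
    unfolding p2 by (simp add: B B'_def real_sqrt_mult real_sqrt_divide)
  have AB: "A * B = 1 / 2"
  proof -
    have "A * B = (2 powr (- 3/4) * 2 powr (- 3/4)) * sqrt ((weber_G1 a / weber_G3 a) * (2 * weber_G3 a / weber_G1 a))"
      by (simp add: A B A'_def B'_def real_sqrt_mult real_sqrt_divide)
    also have "2 powr (- 3/4) * 2 powr (- 3/4) = 2 powr (-1) * (2 powr (- 1/2) :: real)"
      unfolding powr_add[symmetric] by simp
    also have "(weber_G1 a / weber_G3 a) * (2 * weber_G3 a / weber_G1 a) = 2"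
      using G by simp
    also have "2 powr (-1) * 2 powr (- 1/2) * sqrt 2 = (1 / 2 :: real)"
      by (simp add: powr_minus powr_half_sqrt)
    finally show ?thesis .
  qed
  \<comment> \<open>The Gamma quotient in the integral of the odd solution is expressed through A.
    With A * B = 1/2, its contribution B * S * 2 * A^2 becomes A * S, and 2 * B * Y a becomes 4 * A
    * B^2 * Y a, so that A factors out of both coefficients.\<close>
  have A2: "weber_G1 a / (sqrt 2 * weber_G3 a) = 2 * A\<^sup>2"
  proof -
    have "A\<^sup>2 = (2 powr (- 3/4))\<^sup>2 * (weber_G1 a / weber_G3 a)"
      using G by (simp add: A A'_def power_mult_distrib)
    also have "(2 powr (- 3/4))\<^sup>2 = 2 powr (-1) * (2 powr (- 1/2) :: real)"
      unfolding power2_eq_square powr_add[symmetric] by simp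
    also have "2 powr (-1) * (2 powr (- 1/2) :: real) = 1 / (2 * sqrt 2)"
      by (simp add: powr_minus_divide powr_half_sqrt)
    finally show ?thesis by simp
  qed
  define M2 where "M2 = S * (2 * A\<^sup>2) - 2 * Y a"
  have t1: "((\<lambda>R. integral {0..R} (weber_w1 a)) \<longlongrightarrow> M1) at_top"
    unfolding M1_def by (rule tendsto_integral_weber_w1)
  have t2: "((\<lambda>R. integral {0..R} (weber_w2 a)) \<longlongrightarrow> M2) at_top"
    using tendsto_integral_weber_w2[of a] unfolding A2 M2_def S_def .
  have i: "weber_w1 a integrable_on {u..v}" "weber_w2 a integrable_on {u..v}" for u v
    using c by (meson continuous_on_subset integrable_continuous_real subset_UNIV)+
  have cW: "continuous_on UNIV (W a)" "continuous_on UNIV (\<lambda>x. W a (- x))"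
    unfolding Wm by (simp only: Wx[abs_def], (intro continuous_intros c)+)
  have tW: "((\<lambda>R. integral {0..R} (W a)) \<longlongrightarrow> A * M1 - B * M2) at_top"
    unfolding Wx[abs_def] A[symmetric] B[symmetric]
    by (subst Henstock_Kurzweil_Integration.integral_diff)
      (auto intro!: tendsto_intros t1 t2 integrable_on_mult_right i)
  have tWm: "((\<lambda>R. integral {0..R} (\<lambda>x. W a (- x))) \<longlongrightarrow> A * M1 + B * M2) at_top"
    unfolding Wm A[symmetric] B[symmetric]
    by (subst Henstock_Kurzweil_Integration.integral_add)
      (auto intro!: tendsto_intros t1 t2 integrable_on_mult_right i)
  note J = int_to_infty_zero[OF cW(1) tW] int_to_infty_zero[OF cW(2) tWm]
  have W0: "W a 0 = A" by (simp add: A_def)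
  have N0: "NW_hat a 0 = A * ((A * M1 + B * M2) - (A * M1 - B * M2))"
    by (simp add: NW_hat_def J W0 algebra_simps)
  have "(NW_hat a has_real_derivative
      ((- B') * int_to_infty (\<lambda>t. W a (- t)) 0 + (- W a (- 0)) * W a 0) -
      (B' * int_to_infty (W a) 0 + (- W a 0) * W a (- 0))) (at 0)"
    unfolding NW_hat_def[abs_def]
    by (intro DERIV_diff DERIV_mult dW dWm DERIV_int_to_infty[OF cW(2) tWm] DERIV_int_to_infty[OF cW(1) tW])
  then have N1: "deriv (NW_hat a) 0 = - B * ((A * M1 + B * M2) + (A * M1 - B * M2))"
    using DERIV_imp_deriv by (fastforce simp: J B algebra_simps)
  have dB: "deriv (W a) 0 = - B" by (simp add: B_def)
  have "c0_plus a = 2 * (A * B) * (A * M1 + B * M2)"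
    unfolding c0_plus_def N0 N1 dB W0 by (simp add: algebra_simps)
  also have "\<dots> = A * M1 + 2 * A * (A * B) * S - 2 * B * Y a"
    unfolding AB by (simp add: M2_def algebra_simps power2_eq_square) (use AB in algebra)
  also have "\<dots> = A * (M1 + S - 4 * Y a * B\<^sup>2)"
    using AB by algebra
  finally show "c0_plus a = A * (M1 + S - 4 * Y a * B\<^sup>2)" .
  have "c0_minus a = - 2 * (A * B) * (A * M1 - B * M2)"
    unfolding c0_minus_def N0 N1 dB W0 by (simp add: algebra_simps)
  also have "\<dots> = A * (S - M1 - 4 * Y a * B\<^sup>2)"
    using AB unfolding M2_def by algebra
  finally show "c0_minus a = A * (S - M1 - 4 * Y a * B\<^sup>2)" .
qed

text \<open>Changing the sign of a conjugates s. Moduli of Gamma values are insensitive to this,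
  while the imaginary part of h(0) changes sign; so the coefficients at -a need no separate
  integration.\<close>

lemma weber_reflect_parameter:
  shows "weber_G1 (- a) = weber_G1 a" "weber_G3 (- a) = weber_G3 a" "Y (- a) = - Y a"
proof -
  have c: "Complex c (- a / 2) = cnj (Complex c (a / 2))" for c by (simp add: complex_eq_iff)
  show "weber_G1 (- a) = weber_G1 a" "weber_G3 (- a) = weber_G3 a"
    unfolding weber_G1_def weber_G3_def c by (simp_all add: cnj_Gamma[symmetric] del: complex_cnj)
  define s where "s = Complex (1/4) (a / 2)"
  have "weber_osc (cnj s) 0 0 = integral {0..1} (\<lambda>v. cnj (jacobi_weight s (cnj s) v))"
    unfolding weber_osc_zero jacobi_exp_def
    by (intro Henstock_Kurzweil_Integration.integral_cong, subst cnj_jacobi_weight)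
      (simp_all add: jacobi_weight_def mult.commute)
  also have "\<dots> = cnj (weber_osc s 0 0)"
    unfolding weber_osc_zero jacobi_exp_def by (simp add: integral_cnj[symmetric])
  finally show "Y (- a) = - Y a"
    unfolding Y_eq_Im_weber_osc c s_def[symmetric] by simp
qed

theorem theorem2p7:
  fixes a :: real
  assumes "a \<ge> 0"
  shows "(c0_plus a = W a 0 * (sqrt pi * exp (pi * a / 2) *
            (1 + (1 + exp (- 2 * pi * a)) powr (- 1 / 2))
          - 4 * Y a * (deriv (W a) 0)\<^sup>2))
    \<and> (c0_minus a = - W a 0 * (4 * Y a * (deriv (W a) 0)\<^sup>2
          + sqrt pi * exp (- 3 * pi * a / 2) *
            inverse (1 + exp (- 2 * pi * a) + (1 + exp (- 2 * pi * a)) powr (1 / 2))))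
    \<and> (c0_plus (- a) = W a 0 * (4 * Y a * (deriv (W a) 0)\<^sup>2
          + sqrt pi * exp (- pi * a / 2) * (1 + (1 + exp (2 * pi * a)) powr (- 1 / 2))))
    \<and> (c0_minus (- a) = W a 0 * (4 * Y a * (deriv (W a) 0)\<^sup>2
          - sqrt pi * exp (- pi * a / 2) * (1 - (1 + exp (2 * pi * a)) powr (- 1 / 2))))
    \<and> (W a 0 = 2 powr (- 3 / 4) *
          sqrt (cmod (Gamma (Complex (1/4) (a/2)) / Gamma (Complex (3/4) (a/2)))))
    \<and> (deriv (W a) 0 = - (2 powr (- 1 / 4)) *
          sqrt (cmod (Gamma (Complex (3/4) (a/2)) / Gamma (Complex (1/4) (a/2)))))"
proof (intro conjI)
  have W0: "W (- a) 0 = W a 0"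
    unfolding W_zero by (simp add: weber_reflect_parameter)
  have "- deriv (W (- a)) 0 = - deriv (W a) 0"
    unfolding deriv_W_zero by (simp add: weber_reflect_parameter)
  then have W1': "deriv (W (- a)) 0 = deriv (W a) 0" by simp
  show "c0_plus a = W a 0 * (sqrt pi * exp (pi * a / 2) *
            (1 + (1 + exp (- 2 * pi * a)) powr (- 1 / 2))
          - 4 * Y a * (deriv (W a) 0)\<^sup>2)"
    unfolding c0_plus_eq by (simp add: algebra_simps)
  show "c0_minus a = - W a 0 * (4 * Y a * (deriv (W a) 0)\<^sup>2
          + sqrt pi * exp (- 3 * pi * a / 2) *
            inverse (1 + exp (- 2 * pi * a) + (1 + exp (- 2 * pi * a)) powr (1 / 2)))"
  proof -
    \<comment> \<open>What has to be matched is M1 - S, a multiple of 1 - 1 / r with r = sqrt (1 +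
      E). Since E = (r - 1) * (r + 1) and 1 + E + r = r * (r + 1), this equals E / (1 + E + r), and
      the factor E turns exp (pi * a / 2) into exp (- 3 * pi * a / 2).\<close>
    define E where "E = exp (- 2 * pi * a)"
    define r where "r = sqrt (1 + E)"
    have E: "E > 0" by (simp add: E_def)
    have r: "r > 1" "r\<^sup>2 = 1 + E" using E by (simp_all add: r_def)
    have p1: "(1 + E) powr (1 / 2) = r"
      using E by (simp add: r_def powr_half_sqrt)
    have p: "(1 + E) powr (1 / 2) = r" "(1 + E) powr (- 1 / 2) = 1 / r"
      using powr_minus_divide[of "1 + E" "1/2"] by (simp_all add: p1)
    have "exp (- 3 * pi * a / 2) = exp (pi * a / 2) * E"
      unfolding E_def exp_add[symmetric] by (rule arg_cong[of _ _ exp]) (simp add: field_simps)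
    moreover have "E * inverse (1 + E + r) = 1 - 1 / r"
    proof -
      have "1 + E + r = r * (r + 1)" "E = (r - 1) * (r + 1)"
        using r(2) by (simp_all add: power2_eq_square algebra_simps)
      moreover have "(r - 1) * (r + 1) * inverse (r * (r + 1)) = 1 - 1 / r"
      proof -
        have "(r - 1) * (r + 1) * inverse (r * (r + 1)) = (r - 1) * inverse r * ((r + 1) * inverse (r + 1))"
          by simp
        also have "(r + 1) * inverse (r + 1) = 1" using r(1) by (intro right_inverse) simp
        finally show ?thesis using r(1) by (simp add: field_simps)
      qed
      ultimately show ?thesis by (simp only:)
    qed
    ultimately have eq: "sqrt pi * exp (- 3 * pi * a / 2) * inverse (1 + E + r) = sqrt pi * exp (pi * a / 2) * (1 - 1 / r)"
      by (simp add: mult.assoc)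
    show ?thesis
      unfolding c0_minus_eq E_def[symmetric] p eq by (simp add: algebra_simps)
  qed
  show "c0_plus (- a) = W a 0 * (4 * Y a * (deriv (W a) 0)\<^sup>2
          + sqrt pi * exp (- pi * a / 2) * (1 + (1 + exp (2 * pi * a)) powr (- 1 / 2)))"
    unfolding c0_plus_eq W0 W1' by (simp add: weber_reflect_parameter algebra_simps)
  show "c0_minus (- a) = W a 0 * (4 * Y a * (deriv (W a) 0)\<^sup>2
          - sqrt pi * exp (- pi * a / 2) * (1 - (1 + exp (2 * pi * a)) powr (- 1 / 2)))"
    unfolding c0_minus_eq W0 W1' by (simp add: weber_reflect_parameter algebra_simps)
  show "W a 0 = 2 powr (- 3 / 4) *
          sqrt (cmod (Gamma (Complex (1/4) (a/2)) / Gamma (Complex (3/4) (a/2))))"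
    unfolding W_zero by (simp add: weber_G1_def weber_G3_def norm_divide)
  show "deriv (W a) 0 = - (2 powr (- 1 / 4)) *
          sqrt (cmod (Gamma (Complex (3/4) (a/2)) / Gamma (Complex (1/4) (a/2))))"
    using deriv_W_zero[of a] by (simp add: weber_G1_def weber_G3_def norm_divide)
qed

end
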